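(* Let $\mathcal{T}$ be a self-affine tiling of $\mathbb{R}^d$ generated by a primitive substitution rule $\omega$ with finite local complexity and expansion map $Q$, and let $\Xi$ be the set of return vectors of $\mathcal{T}$. Suppose $\mathcal{T}$ has pure discrete dynamical spectrum, and that there are a lattice $L$ of $\mathbb{R}^d$, a positive integer $K$ and a tile $T\in\mathcal{T}$ with $\{T+x: x\in Q^K(L)\}\subset\mathcal{T}$ (equivalently, under pure discrete spectrum: $\Xi\supset Q^K(L)$ for some positive integer $K$). Then $\mathcal{T}$ is limit periodic. In particular, there are a lattice $L'$ of $\mathbb{R}^d$ and a patch $\mathcal{P}\subset\mathcal{T}$ of zero density such that for every $T\in\mathcal{T}\setminus\mathcal{P}$ there is a natural number $l$ with $\{T+x: x\in Q^l(L')\}\subset\mathcal{T}$.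
   Context: A tile in $\mathbb{R}^d$ is a compact set equal to the closure of its interior, possibly carrying a label from a fixed finite set. A patch is a set of tiles any two distinct members of which have disjoint interiors; its support $\operatorname{supp}\mathcal{P}$ is the closure of the union of supports; a tiling is a patch with support $\mathbb{R}^d$. $\mathcal{P}\sqcap S=\{T\in\mathcal{P}:\operatorname{supp}T\cap S\neq\emptyset\}$. A tiling has finite local complexity (FLC) if for each compact $K$ the set $\{\mathcal{T}\sqcap(K+x)\}_x$ is finite up to translation, and is repetitive if every finite patch occurring in it occurs (as a translate) in every ball of some fixed radius. A substitution rule: finite prototile set $\mathcal{A}$, linear $Q$ with all eigenvalues of modulus $>1$, map $\omega$ sending $P\in\mathcal{A}$ to a finite patch of translates of prototiles with $\operatorname{supp}\omega(P)=Q(\operatorname{supp}P)$, extended by $\omega(P+x)=\omega(P)+Qx$ and unions; primitive if some power of its substitution matrix is positive; FLC if for each compact $K$ the set $\{\omega^n(P)\sqcap(K+x)\}_{n>0,P,x}$ is finite up to translation. A self-affine tiling for $\omega$ is a repetitive FLC tiling $\mathcal{T}$ of translates of prototiles with $\omega(\mathcal{T})=\mathcal{T}$. A return vector is $x$ with $T,T+x\in\mathcal{T}$ for some $T$. Pure discrete dynamical spectrum: $L^2(\mu)$ of the unique translation-invariant probability measure $\mu$ on the hull $X_{\mathcal{T}}$ (closure of translates of $\mathcal{T}$ in the local matching topology) has an orthonormal basis of eigenfunctions $f$, i.e. $f(\mathcal{S}-x)=e^{2\pi i\langle x,a\rangle}f(\mathcal{S})$ a.e. for all $x$, for some $a$.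 Density: a van Hove sequence is a sequence $(A_n)$ of measurable sets of positive measure with $\operatorname{vol}(\partial^K A_n)/\operatorname{vol}(A_n)\to0$ for every compact $K$, where $\partial^K A=((K+A)\setminus A^\circ)\cup((-K+\overline{\mathbb{R}^d\setminus A})\cap A)$; $\operatorname{dens}_{(A_n)}\mathcal{P}=\limsup_n \operatorname{vol}(\operatorname{supp}\mathcal{P}\cap A_n)/\operatorname{vol}(A_n)$; $\mathcal{P}$ has zero density if this is $0$ for every van Hove sequence. A tiling $\mathcal{S}$ is limit periodic if there are a zero-density subset $\mathcal{P}\subset\mathcal{S}$ and a decreasing sequence $L_1\supset L_2\supset\cdots$ of lattices such that for every $T\in\mathcal{S}\setminus\mathcal{P}$ there is $n$ with $\{T+x:x\in L_n\}\subset\mathcal{S}$. *)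

theory Defs
  imports "HOL-Probability.Probability"
begin

text \<open>A tile is a pair (support, label). Translation acts on the support only.\<close>
type_synonym ('n, 'l) tile = "(real^'n) set \<times> 'l"

definition is_tile :: "('n::finite, 'l) tile \<Rightarrow> bool" where
  "is_tile T \<longleftrightarrow> compact (fst T) \<and> closure (interior (fst T)) = fst T"

definition tile_translate :: "('n::finite, 'l) tile \<Rightarrow> real^'n \<Rightarrow> ('n, 'l) tile" (infixl "+\<^sub>t" 65) where
  "T +\<^sub>t x = ((\<lambda>y. y + x) ` fst T, snd T)"

definition patch_translate :: "('n::finite, 'l) tile set \<Rightarrow> real^'n \<Rightarrow> ('n, 'l) tile set" (infixl "+\<^sub>p" 65) where
  "P +\<^sub>p x = (\<lambda>T. T +\<^sub>t x) ` P"

definition is_patch :: "('n::finite, 'l) tile set \<Rightarrow> bool" where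
  "is_patch P \<longleftrightarrow> (\<forall>T\<in>P. is_tile T) \<and>
     (\<forall>T\<in>P. \<forall>S\<in>P. T \<noteq> S \<longrightarrow> interior (fst T) \<inter> interior (fst S) = {})"

definition supp :: "('n::finite, 'l) tile set \<Rightarrow> (real^'n) set" where
  "supp P = closure (\<Union>T\<in>P. fst T)"

definition is_tiling :: "('n::finite, 'l) tile set \<Rightarrow> bool" where
  "is_tiling P \<longleftrightarrow> is_patch P \<and> supp P = UNIV"

definition patch_meet :: "('n::finite, 'l) tile set \<Rightarrow> (real^'n) set \<Rightarrow> ('n, 'l) tile set" (infixl "\<sqinter>\<^sub>p" 70) where
  "P \<sqinter>\<^sub>p S = {T\<in>P. fst T \<inter> S \<noteq> {}}"

definition set_translate :: "(real^'n::finite) set \<Rightarrow> real^'n \<Rightarrow> (real^'n) set" where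
  "set_translate K x = (\<lambda>y. y + x) ` K"

definition tiling_FLC :: "('n::finite, 'l) tile set \<Rightarrow> bool" where
  "tiling_FLC \<T> \<longleftrightarrow> (\<forall>K. compact K \<longrightarrow>
     (\<exists>F. finite F \<and> (\<forall>x. \<exists>P\<in>F. \<exists>y. \<T> \<sqinter>\<^sub>p set_translate K x = P +\<^sub>p y)))"

definition repetitive :: "('n::finite, 'l) tile set \<Rightarrow> bool" where
  "repetitive \<T> \<longleftrightarrow> (\<forall>P. finite P \<and> P \<subseteq> \<T> \<longrightarrow>
     (\<exists>R. \<forall>y. \<exists>x. P +\<^sub>p x \<subseteq> \<T> \<and> supp (P +\<^sub>p x) \<subseteq> cball y R))"

definition return_vectors :: "('n::finite, 'l) tile set \<Rightarrow> (real^'n) set" where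
  "return_vectors \<T> = {x. \<exists>T\<in>\<T>. T +\<^sub>t x \<in> \<T>}"

definition complex_eigenvalue :: "real^'n^'n \<Rightarrow> complex \<Rightarrow> bool" where
  "complex_eigenvalue Q c \<longleftrightarrow> (\<exists>v::complex^'n. v \<noteq> 0 \<and>
      (\<chi> i. \<Sum>j\<in>UNIV. complex_of_real (Q $ i $ j) * v $ j) = (\<chi> i. c * v $ i))"

definition expanding :: "real^'n^'n \<Rightarrow> bool" where
  "expanding Q \<longleftrightarrow> (\<forall>c. complex_eigenvalue Q c \<longrightarrow> cmod c > 1)"

definition Qpow :: "real^'n^'n \<Rightarrow> nat \<Rightarrow> real^'n \<Rightarrow> real^'n" where
  "Qpow Q k = ((\<lambda>v. Q *v v) ^^ k)"

definition is_lattice :: "(real^'n::finite) set \<Rightarrow> bool" where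
  "is_lattice L \<longleftrightarrow> (\<exists>B. independent B \<and> span B = UNIV \<and>
      L = {(\<Sum>b\<in>B. of_int (c b) *\<^sub>R b) | c. True})"

definition omega_ext :: "('n::finite, 'l) tile set \<Rightarrow> real^'n^'n \<Rightarrow> (('n,'l) tile \<Rightarrow> ('n,'l) tile set)
    \<Rightarrow> ('n,'l) tile set \<Rightarrow> ('n,'l) tile set" where
  "omega_ext A Q \<omega> \<P> = (\<Union>{\<omega> P +\<^sub>p (Q *v x) | P x. P \<in> A \<and> P +\<^sub>t x \<in> \<P>})"

definition subst_rule :: "('n::finite, 'l) tile set \<Rightarrow> real^'n^'n \<Rightarrow> (('n,'l) tile \<Rightarrow> ('n,'l) tile set) \<Rightarrow> bool" where
  "subst_rule A Q \<omega> \<longleftrightarrow> finite A \<and> (\<forall>P\<in>A. is_tile P) \<and> expanding Q \<and>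
     (\<forall>P\<in>A. finite (\<omega> P) \<and> is_patch (\<omega> P) \<and> (\<forall>T\<in>\<omega> P. \<exists>P'\<in>A. \<exists>x. T = P' +\<^sub>t x) \<and>
              supp (\<omega> P) = (\<lambda>v. Q *v v) ` fst P) \<and>
     (\<forall>P\<in>A. \<forall>P'\<in>A. \<forall>x y. P +\<^sub>t x = P' +\<^sub>t y \<longrightarrow> \<omega> P +\<^sub>p (Q *v x) = \<omega> P' +\<^sub>p (Q *v y))"

definition subst_matrix :: "('n::finite, 'l) tile set \<Rightarrow> (('n,'l) tile \<Rightarrow> ('n,'l) tile set)
     \<Rightarrow> ('n,'l) tile \<Rightarrow> ('n,'l) tile \<Rightarrow> nat" where
  "subst_matrix A \<omega> P P' = card {x. P +\<^sub>t x \<in> \<omega> P'}"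

fun mat_pow_on :: "'a set \<Rightarrow> ('a \<Rightarrow> 'a \<Rightarrow> nat) \<Rightarrow> nat \<Rightarrow> 'a \<Rightarrow> 'a \<Rightarrow> nat" where
  "mat_pow_on I M 0 = (\<lambda>i j. if i = j then 1 else 0)"
| "mat_pow_on I M (Suc k) = (\<lambda>i j. \<Sum>m\<in>I. M i m * mat_pow_on I M k m j)"

definition primitive :: "('n::finite, 'l) tile set \<Rightarrow> (('n,'l) tile \<Rightarrow> ('n,'l) tile set) \<Rightarrow> bool" where
  "primitive A \<omega> \<longleftrightarrow> (\<exists>k>0. \<forall>P\<in>A. \<forall>P'\<in>A. mat_pow_on A (subst_matrix A \<omega>) k P P' > 0)"

definition subst_FLC :: "('n::finite, 'l) tile set \<Rightarrow> real^'n^'n \<Rightarrow> (('n,'l) tile \<Rightarrow> ('n,'l) tile set) \<Rightarrow> bool" where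
  "subst_FLC A Q \<omega> \<longleftrightarrow> (\<forall>K. compact K \<longrightarrow>
     (\<exists>F. finite F \<and> (\<forall>n>0. \<forall>P\<in>A. \<forall>x. \<exists>G\<in>F. \<exists>y.
         ((omega_ext A Q \<omega> ^^ n) {P}) \<sqinter>\<^sub>p set_translate K x = G +\<^sub>p y)))"

definition self_affine_tiling :: "('n::finite, 'l) tile set \<Rightarrow> real^'n^'n \<Rightarrow> (('n,'l) tile \<Rightarrow> ('n,'l) tile set)
     \<Rightarrow> ('n,'l) tile set \<Rightarrow> bool" where
  "self_affine_tiling A Q \<omega> \<T> \<longleftrightarrow> is_tiling \<T> \<and> repetitive \<T> \<and> tiling_FLC \<T> \<and>
     (\<forall>T\<in>\<T>. \<exists>P\<in>A. \<exists>x. T = P +\<^sub>t x) \<and> omega_ext A Q \<omega> \<T> = \<T>"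

definition lm_close :: "real \<Rightarrow> ('n::finite, 'l) tile set \<Rightarrow> ('n, 'l) tile set \<Rightarrow> bool" where
  "lm_close \<epsilon> S1 S2 \<longleftrightarrow> (\<exists>x y. norm x < \<epsilon> \<and> norm y < \<epsilon> \<and>
      (S1 +\<^sub>p (- x)) \<sqinter>\<^sub>p ball 0 (1/\<epsilon>) = (S2 +\<^sub>p (- y)) \<sqinter>\<^sub>p ball 0 (1/\<epsilon>))"

definition tiling_hull :: "('n::finite, 'l) tile set \<Rightarrow> ('n, 'l) tile set set" where
  "tiling_hull \<T> = {S. \<forall>\<epsilon>>0. \<exists>z. lm_close \<epsilon> S (\<T> +\<^sub>p z)}"

definition hull_opens :: "('n::finite, 'l) tile set \<Rightarrow> ('n, 'l) tile set set set" where
  "hull_opens \<T> = {U. U \<subseteq> tiling_hull \<T> \<and>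
      (\<forall>S\<in>U. \<exists>\<epsilon>>0. {S'\<in>tiling_hull \<T>. lm_close \<epsilon> S S'} \<subseteq> U)}"

definition hull_borel :: "('n::finite, 'l) tile set \<Rightarrow> ('n, 'l) tile set measure" where
  "hull_borel \<T> = sigma (tiling_hull \<T>) (hull_opens \<T>)"

definition invariant_prob :: "('n::finite, 'l) tile set \<Rightarrow> ('n, 'l) tile set measure \<Rightarrow> bool" where
  "invariant_prob \<T> M \<longleftrightarrow> prob_space M \<and> sets M = sets (hull_borel \<T>) \<and>
     (\<forall>A\<in>sets M. \<forall>x. emeasure M ((\<lambda>S. S +\<^sub>p x) -` A \<inter> space M) = emeasure M A)"

definition L2 :: "'a measure \<Rightarrow> ('a \<Rightarrow> complex) set" where
  "L2 M = {f. f \<in> borel_measurable M \<and> integrable M (\<lambda>x. (cmod (f x))\<^sup>2)}"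

definition L2_inner :: "'a measure \<Rightarrow> ('a \<Rightarrow> complex) \<Rightarrow> ('a \<Rightarrow> complex) \<Rightarrow> complex" where
  "L2_inner M f g = (LINT x|M. f x * cnj (g x))"

definition eigenfunction :: "('n::finite, 'l) tile set measure \<Rightarrow> (('n, 'l) tile set \<Rightarrow> complex) \<Rightarrow> bool" where
  "eigenfunction M f \<longleftrightarrow> (\<exists>a::real^'n. \<forall>x. AE S in M.
      f (S +\<^sub>p (- x)) = exp (2 * pi * \<i> * complex_of_real (x \<bullet> a)) * f S)"

text \<open>Orthonormal basis of L^2(M) = maximal orthonormal family.\<close>
definition has_eigen_ONB :: "('n::finite, 'l) tile set measure \<Rightarrow> bool" where
  "has_eigen_ONB M \<longleftrightarrow> (\<exists>F. F \<subseteq> L2 M \<and> (\<forall>f\<in>F. eigenfunction M f) \<and>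
      (\<forall>f\<in>F. \<forall>g\<in>F. L2_inner M f g = (if f = g then 1 else 0)) \<and>
      (\<forall>g\<in>L2 M. (\<forall>f\<in>F. L2_inner M g f = 0) \<longrightarrow> (AE x in M. g x = 0)))"

definition pure_discrete_spectrum :: "('n::finite, 'l) tile set \<Rightarrow> bool" where
  "pure_discrete_spectrum \<T> \<longleftrightarrow> (\<exists>M. invariant_prob \<T> M \<and>
      (\<forall>M'. invariant_prob \<T> M' \<longrightarrow> M' = M) \<and> has_eigen_ONB M)"

definition msum :: "(real^'n::finite) set \<Rightarrow> (real^'n) set \<Rightarrow> (real^'n) set" where
  "msum K A = {k + a | k a. k \<in> K \<and> a \<in> A}"

definition vH_boundary :: "(real^'n::finite) set \<Rightarrow> (real^'n) set \<Rightarrow> (real^'n) set" where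
  "vH_boundary K A = (msum K A - interior A) \<union> (msum (uminus ` K) (closure (- A)) \<inter> A)"

definition van_Hove :: "(nat \<Rightarrow> (real^'n::finite) set) \<Rightarrow> bool" where
  "van_Hove A \<longleftrightarrow> (\<forall>n. A n \<in> sets lebesgue \<and> 0 < emeasure lebesgue (A n) \<and> emeasure lebesgue (A n) < \<infinity>) \<and>
     (\<forall>K. compact K \<longrightarrow>
        (\<lambda>n. measure lebesgue (vH_boundary K (A n)) / measure lebesgue (A n)) \<longlonglongrightarrow> 0)"

definition dens :: "(nat \<Rightarrow> (real^'n::finite) set) \<Rightarrow> ('n, 'l) tile set \<Rightarrow> ereal" where
  "dens A \<P> = limsup (\<lambda>n. ereal (measure lebesgue (supp \<P> \<inter> A n) / measure lebesgue (A n)))"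

definition zero_density :: "('n::finite, 'l) tile set \<Rightarrow> bool" where
  "zero_density \<P> \<longleftrightarrow> (\<forall>A. van_Hove A \<longrightarrow> dens A \<P> = 0)"

definition limit_periodic :: "('n::finite, 'l) tile set \<Rightarrow> bool" where
  "limit_periodic \<S> \<longleftrightarrow> (\<exists>\<P> L. \<P> \<subseteq> \<S> \<and> zero_density \<P> \<and>
      (\<forall>n. is_lattice (L n)) \<and> (\<forall>n. L (Suc n) \<subseteq> L n) \<and>
      (\<forall>T\<in>\<S> - \<P>. \<exists>n. \<forall>x\<in>L n. T +\<^sub>t x \<in> \<S>))"

end

theory Submission
  imports Defs "HOL-Computational_Algebra.Fundamental_Theorem_Algebra"
begin

text \<open>
  From \<open>T + Q^K(L)\<close> in the tiling one gets \<open>\<omega>^n(T) + Q^(K+n)(L)\<close> in the tiling, and these patches all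
  cover the same positive proportion of space. Hence two of them overlap, in a tile that is periodic
  under both \<open>Q^n(L)\<close> and \<open>Q^m(L)\<close>, \<open>n < m\<close>. Tiles do not overlap, so the sum of the two lattices is
  discrete, and \<open>R = Q^(m-n)\<close> is rational with respect to \<open>L\<close>. It is even integral, because by finite local
  complexity the return vectors lie in a finitely generated group that contains all \<open>R^j(Q^K(L))\<close>.
  Therefore a sublattice \<open>L'\<close> of \<open>Q^K(L)\<close> satisfies \<open>R(L') \<subseteq> L'\<close>. Let \<open>U n\<close> be the region of the
  tiles that are periodic under \<open>R^n(L')\<close>. The union of the sets \<open>R^(-n)(U n)\<close> is open, \<open>L'\<close>-periodic and
  invariant under \<open>R^(-1)\<close>, so ergodicity of the expanding torus endomorphism \<open>R\<close> shows that its
  complement is a null set, and the density of the complement of \<open>U n\<close> tends to \<open>0\<close>.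
\<close>

subsection \<open>Lattices and fundamental domains\<close>

text \<open>Each substitution step replaces a lattice of periods by its image under
  \<open>Q\<close>, so densities relative to different lattices have to be compared throughout. The
  common yardstick is the density along balls: for a periodic Borel set it equals the relative
  measure in a fundamental domain of any lattice of periods, and linear bijections preserve this
  ratio.

  Nothing makes \<open>Q^K(L)\<close> invariant under a power of \<open>Q\<close>, so its images
  need not be nested and \<open>R\<close> need not act on the quotient torus; \<open>L'\<close>
  repairs both. Rationality of \<open>R\<close> alone does not give \<open>L'\<close>, since the
  denominators of the powers \<open>R^j\<close> could grow with \<open>j\<close>. Finite generation
  is what bounds them all by one number.

  Tile boundaries are never shown to be null sets. Regions made of tiles are therefore replaced by
  interiors of closures and are separated by topological arguments; measure enters only through open
  or closed periodic sets.\<close>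

global_interpretation zmod: module "\<lambda>(k::int) (x::'a::real_vector). of_int k *\<^sub>R x"
  defines int_submodule = zmod.subspace
    and int_span = zmod.span
  by unfold_locales (auto simp: algebra_simps)

lemma int_submodule_closed:
  fixes x y :: "'a::real_vector"
  assumes "int_submodule H" "x \<in> H" "y \<in> H"
  shows "x + y \<in> H" "x - y \<in> H" "- x \<in> H" "of_int k *\<^sub>R x \<in> H"
  using assms zmod.subspace_add zmod.subspace_diff zmod.subspace_neg zmod.subspace_scale by auto

lemma int_span_finite:
  "finite B \<Longrightarrow> int_span B = {(\<Sum>b\<in>B. of_int (c b) *\<^sub>R b) | c. True}"
  unfolding zmod.span_finite by blast

lemma is_lattice_iff:
  "is_lattice L \<longleftrightarrow> (\<exists>B. independent B \<and> span B = UNIV \<and> L = int_span B)"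
proof -
  have "L = {(\<Sum>b\<in>B. of_int (c b) *\<^sub>R b) | c. True} \<longleftrightarrow> L = int_span B" if "independent B" for B
    using int_span_finite[OF independent_imp_finite[OF that]] by simp
  then show ?thesis unfolding is_lattice_def by (intro ex_cong1) auto
qed

lemma is_latticeE:
  assumes "is_lattice L"
  obtains B where "independent B" "finite B" "span B = UNIV" "L = int_span B"
  using assms independent_imp_finite unfolding is_lattice_iff by blast

lemma countable_int_span:
  assumes "finite B" shows "countable (int_span B)"
proof -
  have "int_span B \<subseteq> (\<lambda>c. \<Sum>b\<in>B. of_int (c b) *\<^sub>R b) ` (B \<rightarrow>\<^sub>E UNIV)"
  proof
    fix x assume "x \<in> int_span B"
    then obtain c where "x = (\<Sum>b\<in>B. of_int (c b) *\<^sub>R b)"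
      using int_span_finite[OF assms] by auto
    then have "x = (\<Sum>b\<in>B. of_int (restrict c B b) *\<^sub>R b)" by (simp cong: sum.cong)
    then show "x \<in> (\<lambda>c. \<Sum>b\<in>B. of_int (c b) *\<^sub>R b) ` (B \<rightarrow>\<^sub>E UNIV)"
      by (rule image_eqI[of _ _ "restrict c B"]) auto
  qed
  moreover have "countable (B \<rightarrow>\<^sub>E (UNIV::int set))"
    by (rule countable_PiE) (auto simp: assms)
  ultimately show ?thesis by (meson countable_subset countable_image)
qed

lemma is_lattice_countable: "is_lattice L \<Longrightarrow> countable L"
  by (elim is_latticeE) (simp add: countable_int_span)

lemma is_lattice_submodule: "is_lattice L \<Longrightarrow> int_submodule L"
  by (elim is_latticeE) (simp add: zmod.subspace_span)

lemma span_lattice: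
  assumes "is_lattice L" shows "span L = UNIV"
proof -
  obtain B where B: "span B = UNIV" "L = int_span B" using is_latticeE[OF assms] by blast
  have "B \<subseteq> L" unfolding B(2) by (rule zmod.span_superset)
  then show ?thesis using B(1) span_mono by blast
qed

lemma int_span_subset_span: "int_span B \<subseteq> span (B :: 'a::real_vector set)"
proof
  fix x assume "x \<in> int_span B"
  then show "x \<in> span B"
    by (induction rule: zmod.span_induct_alt) (auto intro: span_add span_scale span_zero span_base)
qed

lemma linear_image_int_span:
  assumes "linear f" shows "f ` int_span B = int_span (f ` B)"
proof -
  interpret f: linear f by fact
  have "module_hom (\<lambda>(k::int) x. of_int k *\<^sub>R x) (\<lambda>(k::int) x. of_int k *\<^sub>R x) f"
    by unfold_locales (auto simp: f.add f.scale)
  then interpret module_hom "\<lambda>(k::int) x. of_int k *\<^sub>R x" "\<lambda>(k::int) x. of_int k *\<^sub>R x" f .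
  show ?thesis using span_image[of B] by (simp add: int_span_def)
qed

lemma int_submodule_linear_image:
  assumes "linear f" "int_submodule H" shows "int_submodule (f ` H)"
proof -
  have "int_span H = H" using assms(2) zmod.span_eq_iff by blast
  then have "f ` H = int_span (f ` H)" using linear_image_int_span[OF assms(1)] by metis
  then show ?thesis by (metis zmod.subspace_span)
qed

lemma is_lattice_linear_image:
  fixes f :: "real^'n::finite \<Rightarrow> real^'n"
  assumes "is_lattice L" "linear f" "bij f"
  shows "is_lattice (f ` L)"
proof -
  obtain B where B: "independent B" "span B = UNIV" "L = int_span B"
    using is_latticeE[OF assms(1)] by blast
  have "independent (f ` B)"
    using linear_independent_injective_image[OF assms(2) B(1)] bij_is_inj[OF assms(3)]
    by (simp add: inj_on_subset)
  moreover have "span (f ` B) = UNIV"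
    using linear_span_image[OF assms(2), of B] B(2) bij_is_surj[OF assms(3)] by simp
  ultimately show ?thesis
    unfolding is_lattice_iff B(3) linear_image_int_span[OF assms(2)] by auto
qed

section \<open>Subgroups of lattices\<close>

lemma int_ideal_principal:
  fixes I :: "int set"
  assumes "0 \<in> I" "\<And>a b. a \<in> I \<Longrightarrow> b \<in> I \<Longrightarrow> a - b \<in> I"
  obtains c where "c \<in> I" "\<And>k. k \<in> I \<Longrightarrow> c dvd k"
proof (cases "I = {0}")
  case True then show ?thesis using that[of 0] by auto
next
  case False
  have neg: "- a \<in> I" if "a \<in> I" for a using assms(2)[OF assms(1) that] by simp
  have add: "a + b \<in> I" if "a \<in> I" "b \<in> I" for a b
    using assms(2)[OF that(1) neg[OF that(2)]] by simp
  have mult_nat: "int n * a \<in> I" if "a \<in> I" for a n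
    by (induction n) (auto simp: algebra_simps assms(1) intro: add that)
  have mult: "k * a \<in> I" if "a \<in> I" for a k
  proof (cases "k \<ge> 0")
    case True then show ?thesis using mult_nat[OF that, of "nat k"] by simp
  next
    case False then show ?thesis using neg[OF mult_nat[OF that, of "nat (- k)"]] by simp
  qed
  obtain a where "a \<in> I" "a \<noteq> 0" using False assms(1) by blast
  then have "\<exists>n::nat. n > 0 \<and> int n \<in> I"
    using neg by (intro exI[of _ "nat \<bar>a\<bar>"]) (auto simp: abs_if)
  then obtain n where n: "n > 0" "int n \<in> I" "\<And>m. m > 0 \<Longrightarrow> int m \<in> I \<Longrightarrow> n \<le> m"
    using exists_least_iff[of "\<lambda>n. n > 0 \<and> int n \<in> I"] by (metis not_less)
  have "int n dvd k" if "k \<in> I" for k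
  proof -
    have "k mod int n = k - (k div int n) * int n" by (simp add: minus_div_mult_eq_mod)
    then have r: "k mod int n \<in> I" using assms(2)[OF that mult[OF n(2)]] by metis
    have b: "0 \<le> k mod int n" "k mod int n < int n" using n(1) by auto
    have "k mod int n = 0"
    proof (rule ccontr)
      assume "k mod int n \<noteq> 0"
      then have "nat (k mod int n) > 0" "int (nat (k mod int n)) \<in> I" using b r by auto
      then have "n \<le> nat (k mod int n)" using n(3) by blast
      then show False using b by linarith
    qed
    then show ?thesis by auto
  qed
  then show ?thesis using that n(2) by blast
qed

text \<open>Induction on \<open>D\<close>: after splitting off a generator \<open>d\<close>, the
  group \<open>H\<close> is generated by its part in \<open>int_span D\<close> and one element
  \<open>h\<close> whose \<open>d\<close>-coefficient divides all others. The cardinality bound is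
  carried along because it later turns generators of a spanning subgroup into a basis.\<close>

lemma int_submodule_finitely_generated:
  fixes D :: "'a::real_vector set"
  assumes "finite D" "int_submodule H" "H \<subseteq> int_span D"
  shows "\<exists>D'. finite D' \<and> card D' \<le> card D \<and> H = int_span D'"
  using assms
proof (induction D arbitrary: H rule: finite_induct)
  case empty
  then have "H \<subseteq> {0}" by simp
  then have "H = int_span {}" using empty(1) zmod.subspace_0 by auto
  then show ?case by fastforce
next
  case (insert d D)
  \<comment> \<open>\<open>D\<close> may be dependent over the integers, so one element of
    \<open>H\<close> can contribute several coefficients to \<open>I\<close>.\<close>
  define I where "I = {k::int. \<exists>u\<in>int_span D. of_int k *\<^sub>R d + u \<in> H}"
  have "0 \<in> I" unfolding I_def using zmod.span_zero zmod.subspace_0[OF insert(4)] by force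
  moreover have "a - b \<in> I" if ab: "a \<in> I" "b \<in> I" for a b
  proof -
    obtain u v where uv: "u \<in> int_span D" "v \<in> int_span D"
        "of_int a *\<^sub>R d + u \<in> H" "of_int b *\<^sub>R d + v \<in> H"
      using ab unfolding I_def by blast
    have "of_int (a - b) *\<^sub>R d + (u - v) = (of_int a *\<^sub>R d + u) - (of_int b *\<^sub>R d + v)"
      by (simp add: algebra_simps)
    also have "\<dots> \<in> H" using uv int_submodule_closed(2)[OF insert(4)] by blast
    finally show ?thesis using zmod.span_diff[OF uv(1,2)] unfolding I_def by blast
  qed
  ultimately obtain c where c: "c \<in> I" "\<And>k. k \<in> I \<Longrightarrow> c dvd k"
    using int_ideal_principal by metis
  then obtain u where u: "u \<in> int_span D" "of_int c *\<^sub>R d + u \<in> H" unfolding I_def by blast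
  define h where "h = of_int c *\<^sub>R d + u"
  have "int_submodule (H \<inter> int_span D)"
    using insert(4) zmod.subspace_inter zmod.subspace_span by blast
  then obtain D' where D': "finite D'" "card D' \<le> card D" "H \<inter> int_span D = int_span D'"
    using insert.IH[of "H \<inter> int_span D"] by blast
  have "H = int_span (insert h D')"
  proof
    have "D' \<subseteq> H" using D'(3) zmod.span_superset[of D'] by blast
    then show "int_span (insert h D') \<subseteq> H"
      using u(2) insert(4) by (intro zmod.span_minimal) (auto simp: h_def)
    show "H \<subseteq> int_span (insert h D')"
    proof
      fix y assume y: "y \<in> H"
      then obtain k where k: "y - of_int k *\<^sub>R d \<in> int_span D"
        using insert(5) zmod.span_breakdown_eq[of y d D] by auto
      have "of_int k *\<^sub>R d + (y - of_int k *\<^sub>R d) \<in> H" using y by simp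
      then have "k \<in> I" unfolding I_def using k by blast
      then obtain q where q: "k = c * q" using c(2) by blast
      have "y - of_int q *\<^sub>R h = (y - of_int k *\<^sub>R d) - of_int q *\<^sub>R u"
        by (simp add: h_def q algebra_simps)
      also have "\<dots> \<in> int_span D" by (intro zmod.span_diff k zmod.span_scale u(1))
      finally have "y - of_int q *\<^sub>R h \<in> H \<inter> int_span D"
        using int_submodule_closed(2)[OF insert(4) y int_submodule_closed(4)[OF insert(4) u(2)[folded h_def] y]] u(2)
        by (simp add: h_def)
      then show "y \<in> int_span (insert h D')" using D'(3) zmod.span_breakdown_eq[of y h D'] by auto
    qed
  qed
  moreover have "card (insert h D') \<le> card (insert d D)"
    using D' insert(1,2) by (simp add: card_insert_if)
  ultimately show ?case using D'(1) by blast
qed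

text \<open>The subgroup has at most as many generators as the dimension, and a spanning set of that
  size is independent.\<close>

lemma is_lattice_submodule_spanning:
  fixes L :: "(real^'n::finite) set"
  assumes "is_lattice L" "int_submodule H" "H \<subseteq> L" "span H = UNIV"
  shows "is_lattice H"
proof -
  obtain B where B: "independent B" "span B = UNIV" "L = int_span B"
    using is_latticeE[OF assms(1)] by blast
  then obtain D where D: "finite D" "card D \<le> card B" "H = int_span D"
    using int_submodule_finitely_generated[OF independent_imp_finite assms(2)] assms(3) by blast
  have "span H \<subseteq> span D" unfolding D(3)
    using int_span_subset_span[of D] span_minimal subspace_span by blast
  then have sp: "span D = UNIV" using assms(4) by blast
  have "card B = dim (UNIV :: (real^'n) set)"
    using B(1,2) basis_card_eq_dim[of B UNIV] by simp
  then have "independent D"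
    using card_le_dim_spanning[of D UNIV] D(1,2) sp by simp
  then show ?thesis using sp D(3) is_lattice_iff by blast
qed

text \<open>Exactly one representative of each coset, rather than one up to null sets, so that
  decompositions into lattice translates have no exceptional points.\<close>

definition fundamental_domain :: "(real^'n::finite) set \<Rightarrow> (real^'n) set \<Rightarrow> bool" where
  "fundamental_domain L F \<longleftrightarrow> F \<in> sets borel \<and> bounded F \<and> (\<forall>z. \<exists>!x. x \<in> L \<and> z - x \<in> F)"

text \<open>The half-open parallelepiped over a lattice basis serves; the lattice vector that moves
  \<open>z\<close> into it comes from rounding the coordinates of \<open>z\<close> down.\<close>

lemma lattice_fundamental_domain:
  fixes L :: "(real^'n::finite) set"
  assumes "is_lattice L"
  shows "\<exists>F. fundamental_domain L F"
proof -
  obtain B where B: "independent B" "span B = UNIV" "L = int_span B"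
    using is_latticeE[OF assms] by blast
  have fin: "finite B" using B(1) independent_imp_finite by blast
  define r where "r = representation B"
  define F where "F = {v. \<forall>b\<in>B. 0 \<le> r v b \<and> r v b < 1}"
  have lin: "linear (\<lambda>v. r v b)" for b
    unfolding r_def by (rule linearI) (simp_all add: representation_add representation_scale B(1,2))
  have ex: "v = (\<Sum>b\<in>B. r v b *\<^sub>R b)" for v
    unfolding r_def by (rule sum_representation_eq[symmetric]) (auto simp: B fin)
  have rsum: "r (\<Sum>b\<in>B. c b *\<^sub>R b) a = c a" if "a \<in> B" for c a
  proof -
    have "r (\<Sum>b\<in>B. c b *\<^sub>R b) a = (\<Sum>b\<in>B. r (c b *\<^sub>R b) a)"
      using linear_sum[OF lin[of a], of "\<lambda>b. c b *\<^sub>R b" B] by simp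
    also have "\<dots> = (\<Sum>b\<in>B. c b * r b a)"
      using linear_cmul[OF lin[of a]] by simp
    also have "\<dots> = (\<Sum>b\<in>B. if b = a then c b else 0)"
      unfolding r_def using B(1) by (intro sum.cong) (auto simp: representation_basis)
    finally show ?thesis using that fin by simp
  qed
  have "(\<lambda>v. r v b) \<in> borel_measurable borel" for b
    using linear_continuous_on[of "\<lambda>v. r v b" UNIV] lin linear_conv_bounded_linear
      borel_measurable_continuous_onI by blast
  then have "F \<in> sets borel" unfolding F_def using fin by measurable
  moreover have "bounded F"
  proof (rule boundedI)
    fix v assume v: "v \<in> F"
    have "norm v \<le> (\<Sum>b\<in>B. norm (r v b *\<^sub>R b))" using ex[of v] norm_sum by metis
    also have "\<dots> \<le> (\<Sum>b\<in>B. norm b)"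
    proof (rule sum_mono)
      fix b assume "b \<in> B"
      then have "0 \<le> r v b" "r v b \<le> 1" using v unfolding F_def by (auto intro: less_imp_le)
      then show "norm (r v b *\<^sub>R b) \<le> norm b" by (simp add: mult_left_le_one_le)
    qed
    finally show "norm v \<le> (\<Sum>b\<in>B. norm b)" .
  qed
  moreover have "\<exists>!x. x \<in> L \<and> z - x \<in> F" for z
  proof -
    have key: "z - (\<Sum>b\<in>B. of_int (c b) *\<^sub>R b) \<in> F \<longleftrightarrow> (\<forall>b\<in>B. c b = \<lfloor>r z b\<rfloor>)" for c :: "_ \<Rightarrow> int"
    proof -
      have "r (z - (\<Sum>b\<in>B. of_int (c b) *\<^sub>R b)) a = r z a - of_int (c a)" if "a \<in> B" for a
        using linear_diff[OF lin[of a]] rsum[OF that] by simp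
      then have "z - (\<Sum>b\<in>B. of_int (c b) *\<^sub>R b) \<in> F \<longleftrightarrow>
          (\<forall>b\<in>B. 0 \<le> r z b - of_int (c b) \<and> r z b - of_int (c b) < 1)"
        unfolding F_def by simp
      also have "\<dots> \<longleftrightarrow> (\<forall>b\<in>B. \<lfloor>r z b\<rfloor> = c b)"
        unfolding floor_eq_iff by (intro ball_cong) auto
      finally show ?thesis by (simp add: eq_commute)
    qed
    define x where "x = (\<Sum>b\<in>B. of_int \<lfloor>r z b\<rfloor> *\<^sub>R b)"
    have "x \<in> L \<and> z - x \<in> F"
      unfolding B(3) x_def int_span_finite[OF fin] using key[of "\<lambda>b. \<lfloor>r z b\<rfloor>"] by auto
    moreover have "y = x" if "y \<in> L \<and> z - y \<in> F" for y
    proof -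
      have "y \<in> L" using that by simp
      then obtain c where c: "y = (\<Sum>b\<in>B. of_int (c b) *\<^sub>R b)"
        unfolding B(3) int_span_finite[OF fin] by auto
      then have "\<forall>b\<in>B. c b = \<lfloor>r z b\<rfloor>" using key that by blast
      then show ?thesis unfolding c x_def by (intro sum.cong) auto
    qed
    ultimately show ?thesis by blast
  qed
  ultimately show ?thesis unfolding fundamental_domain_def by blast
qed

section \<open>Linear bijections\<close>

lemma linear_bij_homeo:
  fixes f :: "real^'n::finite \<Rightarrow> real^'n"
  assumes "linear f" "bij f"
  shows "linear (inv f)" "bij (inv f)" "continuous_on S f" "continuous_on S (inv f)"
    "f \<in> borel_measurable borel" "inv f \<in> borel_measurable borel"
    "X \<in> sets borel \<Longrightarrow> f ` X \<in> sets borel"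
proof -
  show l: "linear (inv f)" using assms bij_is_inj inj_linear_imp_inv_linear by blast
  show "bij (inv f)" using assms bij_imp_bij_inv by blast
  show "continuous_on S f" for S using assms linear_continuous_on linear_conv_bounded_linear by blast
  then show "f \<in> borel_measurable borel" by (intro borel_measurable_continuous_onI)
  show "continuous_on S (inv f)" for S using l linear_continuous_on linear_conv_bounded_linear by blast
  then show m: "inv f \<in> borel_measurable borel" by (intro borel_measurable_continuous_onI)
  show "f ` X \<in> sets borel" if "X \<in> sets borel"
  proof -
    have "f ` X = inv f -` X" using bij_vimage_eq_inv_image[of "inv f"] assms
      by (simp add: bij_imp_bij_inv inv_inv_eq)
    then show ?thesis using measurable_sets[OF m that] by simp
  qed
qed

lemma fundamental_domain_linear_image:
  fixes f :: "real^'n::finite \<Rightarrow> real^'n"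
  assumes "fundamental_domain L F" "linear f" "bij f"
  shows "fundamental_domain (f ` L) (f ` F)"
proof -
  have inj: "inj f" "surj f" using assms bij_is_inj bij_is_surj by auto
  have "\<exists>!x. x \<in> f ` L \<and> z - x \<in> f ` F" for z
  proof -
    have e: "z - f x \<in> f ` F \<longleftrightarrow> inv f z - x \<in> F" for x
    proof -
      have "z - f x = f (inv f z - x)" using linear_diff[OF assms(2)] surj_f_inv_f[OF inj(2)] by simp
      then show ?thesis using inj(1) inj_image_mem_iff by metis
    qed
    obtain x where x: "x \<in> L" "inv f z - x \<in> F" "\<And>y. y \<in> L \<Longrightarrow> inv f z - y \<in> F \<Longrightarrow> y = x"
      using assms(1) unfolding fundamental_domain_def by metis
    show ?thesis
    proof (rule ex1I[of _ "f x"])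
      show "f x \<in> f ` L \<and> z - f x \<in> f ` F" using x(1,2) e by blast
      fix w assume "w \<in> f ` L \<and> z - w \<in> f ` F"
      then obtain y where "w = f y" "y \<in> L" "inv f z - y \<in> F" using e by blast
      then show "w = f x" using x(3) by blast
    qed
  qed
  moreover have "bounded (f ` F)"
    using assms bounded_linear_image linear_conv_bounded_linear unfolding fundamental_domain_def by blast
  moreover have "f ` F \<in> sets borel"
    using linear_bij_homeo(7)[OF assms(2,3)] assms(1) unfolding fundamental_domain_def by blast
  ultimately show ?thesis unfolding fundamental_domain_def by blast
qed

subsection \<open>Densities of periodic sets\<close>

lemma emeasure_lborel_shift:
  fixes S :: "'a::euclidean_space set"
  assumes "S \<in> sets borel"
  shows "emeasure lborel {y. y + x \<in> S} = emeasure lborel S"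
proof -
  have "emeasure lborel S = emeasure (distr lborel borel ((+) x)) S" by (simp add: lborel_distr_plus)
  also have "\<dots> = emeasure lborel {y. y + x \<in> S}"
    using assms by (subst emeasure_distr) (auto simp: vimage_def add.commute)
  finally show ?thesis by simp
qed

definition periodic_set :: "(real^'n) set \<Rightarrow> (real^'n) set \<Rightarrow> bool" where
  "periodic_set L Y \<longleftrightarrow> (\<forall>x\<in>L. \<forall>y. y + x \<in> Y \<longleftrightarrow> y \<in> Y)"

text \<open>Lattice vectors cut \<open>F\<close> into countably many pieces and move them onto a
  partition of \<open>G\<close>; a periodic set has the same share in a piece and in its
  translate.\<close>

lemma periodic_measure_eq:
  fixes Y :: "(real^'n::finite) set"
  assumes F: "fundamental_domain L F" and G: "fundamental_domain L G"
    and L: "countable L" "int_submodule L"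
    and Y: "Y \<in> sets borel" "periodic_set L Y"
  shows "emeasure lborel (Y \<inter> F) = emeasure lborel (Y \<inter> G)"
proof -
  have m [measurable]: "F \<in> sets borel" "G \<in> sets borel" "Y \<in> sets borel"
    using F G Y unfolding fundamental_domain_def by auto
  have uF: "\<And>z x y. x \<in> L \<Longrightarrow> y \<in> L \<Longrightarrow> z - x \<in> F \<Longrightarrow> z - y \<in> F \<Longrightarrow> x = y"
    using F unfolding fundamental_domain_def by metis
  have uG: "\<And>z x y. x \<in> L \<Longrightarrow> y \<in> L \<Longrightarrow> z - x \<in> G \<Longrightarrow> z - y \<in> G \<Longrightarrow> x = y"
    using G unfolding fundamental_domain_def by metis
  have exF: "\<And>z. \<exists>x\<in>L. z - x \<in> F" and exG: "\<And>z. \<exists>x\<in>L. z - x \<in> G"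
    using F G unfolding fundamental_domain_def by metis+
  have neg: "- x \<in> L" if "x \<in> L" for x using L(2) that int_submodule_closed(3) by blast
  have "Y \<inter> F = (\<Union>x\<in>L. {y \<in> Y \<inter> F. y - x \<in> G})" using exG by fastforce
  then have "emeasure lborel (Y \<inter> F) = emeasure lborel (\<Union>x\<in>L. {y \<in> Y \<inter> F. y - x \<in> G})"
    by (rule arg_cong)
  also have "\<dots> = (\<integral>\<^sup>+x. emeasure lborel {y \<in> Y \<inter> F. y - x \<in> G} \<partial>count_space L)"
    using uG by (intro emeasure_UN_countable L) (auto simp: disjoint_family_on_def)
  also have "\<dots> = (\<integral>\<^sup>+x. emeasure lborel {y \<in> Y \<inter> G. y + x \<in> F} \<partial>count_space L)"
  proof (rule nn_integral_cong)
    fix x assume "x \<in> space (count_space L)"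
    then have "x \<in> L" by simp
    then have "{y \<in> Y \<inter> G. y + x \<in> F} = {y. y + x \<in> {y \<in> Y \<inter> F. y - x \<in> G}}"
      using Y(2) unfolding periodic_set_def by auto
    then show "emeasure lborel {y \<in> Y \<inter> F. y - x \<in> G} = emeasure lborel {y \<in> Y \<inter> G. y + x \<in> F}"
      by (simp only:) (subst emeasure_lborel_shift, auto)
  qed
  also have "\<dots> = emeasure lborel (\<Union>x\<in>L. {y \<in> Y \<inter> G. y + x \<in> F})"
  proof (rule emeasure_UN_countable[symmetric])
    show "disjoint_family_on (\<lambda>x. {y \<in> Y \<inter> G. y + x \<in> F}) L"
      unfolding disjoint_family_on_def
    proof (intro ballI impI)
      fix x y assume "x \<in> L" "y \<in> L" "x \<noteq> y"
      then show "{z \<in> Y \<inter> G. z + x \<in> F} \<inter> {z \<in> Y \<inter> G. z + y \<in> F} = {}"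
        using uF[OF neg[of x] neg[of y]] by auto
    qed
  qed (use L in auto)
  also have "(\<Union>x\<in>L. {y \<in> Y \<inter> G. y + x \<in> F}) = Y \<inter> G"
  proof -
    have "\<exists>x\<in>L. z + x \<in> F" for z
      using exF[of z] neg by (metis diff_conv_add_uminus)
    then show ?thesis by blast
  qed
  finally show ?thesis .
qed

lemma fundamental_domain_shift:
  fixes F :: "(real^'n::finite) set"
  assumes "fundamental_domain L F" shows "fundamental_domain L {y. y - a \<in> F}"
proof -
  have [measurable]: "F \<in> sets borel" using assms unfolding fundamental_domain_def by auto
  have "{y. y - a \<in> F} = (\<lambda>y. a + y) ` F" by (auto simp: image_iff algebra_simps) (metis diff_add_cancel)
  then have "bounded {y. y - a \<in> F}"
    using assms bounded_translation[of F a] unfolding fundamental_domain_def by simp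
  moreover have "{y. y - a \<in> F} \<in> sets borel" by measurable
  moreover have "\<exists>!x. x \<in> L \<and> z - x \<in> {y. y - a \<in> F}" for z
  proof -
    have "z - x - a = (z - a) - x" for x by simp
    then show ?thesis using assms unfolding fundamental_domain_def mem_Collect_eq by metis
  qed
  ultimately show ?thesis unfolding fundamental_domain_def by blast
qed

lemma fundamental_domain_measure:
  fixes F :: "(real^'n::finite) set"
  assumes F: "fundamental_domain L F" and L: "countable L"
  shows "emeasure lborel F < \<infinity>" "measure lborel F > 0"
proof -
  have m [measurable]: "F \<in> sets borel" using F unfolding fundamental_domain_def by auto
  show fin: "emeasure lborel F < \<infinity>"
    using F emeasure_bounded_finite unfolding fundamental_domain_def by blast
  have "emeasure lborel F \<noteq> 0"
  proof
    assume "emeasure lborel F = 0"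
    then have "{y. y + (- x) \<in> F} \<in> null_sets lborel" for x
      using emeasure_lborel_shift[OF m, of "- x"] by (intro null_setsI) (simp only:, measurable)
    then have "(\<Union>x\<in>L. {y. y + (- x) \<in> F}) \<in> null_sets lborel"
      by (intro null_sets_UN' L)
    moreover have "(\<Union>x\<in>L. {y. y + (- x) \<in> F}) = UNIV"
    proof -
      have "\<exists>x\<in>L. z - x \<in> F" for z using F unfolding fundamental_domain_def by metis
      then show ?thesis by auto
    qed
    ultimately have "emeasure lborel (UNIV :: (real^'n) set) = 0" by (metis null_setsD1)
    then show False by simp
  qed
  then show "measure lborel F > 0" using fin
    by (simp add: measure_def enn2real_positive_iff zero_less_iff_neq_zero)
qed

lemma emeasure_pair_Collect:
  fixes A Y :: "'a::euclidean_space set"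
  assumes [measurable]: "A \<in> sets borel" "Y \<in> sets borel"
  shows "emeasure lborel {a \<in> A. a + k \<in> Y} = (\<integral>\<^sup>+a. indicator A a * indicator Y (a + k) \<partial>lborel)"
proof -
  have "(\<integral>\<^sup>+a. indicator A a * indicator Y (a + k) \<partial>lborel) = (\<integral>\<^sup>+a. indicator {a \<in> A. a + k \<in> Y} a \<partial>lborel)"
    by (intro nn_integral_cong) (auto split: split_indicator)
  then show ?thesis by simp
qed

text \<open>For fixed \<open>a\<close>, the domain \<open>F\<close> shifted by \<open>a\<close> is
  again fundamental, so the integral over \<open>k\<close> does not depend on \<open>a\<close>.
  Fubini then yields an exact average without any boundary error.\<close>

lemma average_over_fundamental_domain:
  fixes Y A :: "(real^'n::finite) set"
  assumes F: "fundamental_domain L F" and L: "countable L" "int_submodule L"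
    and Y: "Y \<in> sets borel" "periodic_set L Y" and A: "A \<in> sets borel"
  shows "(\<integral>\<^sup>+k. indicator F k * emeasure lborel {a \<in> A. a + k \<in> Y} \<partial>lborel) =
    emeasure lborel A * emeasure lborel (Y \<inter> F)"
proof -
  have m [measurable]: "F \<in> sets borel" "A \<in> sets borel" "Y \<in> sets borel"
    using F Y A unfolding fundamental_domain_def by auto
  have "(\<integral>\<^sup>+k. indicator F k * emeasure lborel {a \<in> A. a + k \<in> Y} \<partial>lborel) =
      (\<integral>\<^sup>+k. (\<integral>\<^sup>+a. indicator F k * (indicator A a * indicator Y (a + k)) \<partial>lborel) \<partial>lborel)"
    by (simp add: emeasure_pair_Collect nn_integral_cmult)
  also have "\<dots> = (\<integral>\<^sup>+a. (\<integral>\<^sup>+k. indicator F k * (indicator A a * indicator Y (a + k)) \<partial>lborel) \<partial>lborel)"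
    by (rule lborel_pair.Fubini') measurable
  also have "\<dots> = (\<integral>\<^sup>+a. indicator A a * emeasure lborel (Y \<inter> F) \<partial>lborel)"
  proof (rule nn_integral_cong)
    fix a :: "real^'n"
    have "(\<integral>\<^sup>+k. indicator F k * (indicator A a * indicator Y (a + k)) \<partial>lborel) =
      (\<integral>\<^sup>+k. indicator A a * (indicator F k * indicator Y (k + a)) \<partial>lborel)"
      by (intro nn_integral_cong) (simp add: ac_simps)
    also have "\<dots> = indicator A a * emeasure lborel {k \<in> F. k + a \<in> Y}"
      by (simp add: emeasure_pair_Collect nn_integral_cmult)
    also have "{k \<in> F. k + a \<in> Y} = {k. k + a \<in> Y \<inter> {y. y - a \<in> F}}" by auto
    also have "emeasure lborel \<dots> = emeasure lborel (Y \<inter> {y. y - a \<in> F})"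
      by (rule emeasure_lborel_shift) measurable
    also have "\<dots> = emeasure lborel (Y \<inter> F)"
      by (rule periodic_measure_eq[OF fundamental_domain_shift[OF F] F L Y])
    finally show "(\<integral>\<^sup>+k. indicator F k * (indicator A a * indicator Y (a + k)) \<partial>lborel) =
      indicator A a * emeasure lborel (Y \<inter> F)" .
  qed
  finally show ?thesis by (simp add: nn_integral_multc)
qed

text \<open>Counting lattice cells inside \<open>A n\<close> would require control of a whole
  neighbourhood of its boundary. Averaging over all shifts \<open>k\<close> in \<open>F\<close>
  needs the Foelner condition only for one translation at a time.\<close>

lemma periodic_density:
  fixes Y :: "(real^'n::finite) set" and A :: "nat \<Rightarrow> (real^'n) set"
  assumes F: "fundamental_domain L F" and L: "countable L" "int_submodule L"
    and Y: "Y \<in> sets borel" "periodic_set L Y"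
    and A: "\<And>n. A n \<in> sets borel" "\<And>n. emeasure lborel (A n) < \<infinity>" "\<And>n. measure lborel (A n) > 0"
    and Foelner: "\<And>k. (\<lambda>n. measure lborel ({y. y - k \<in> A n} - A n) / measure lborel (A n)) \<longlonglongrightarrow> 0"
  shows "(\<lambda>n. measure lborel (Y \<inter> A n) / measure lborel (A n)) \<longlonglongrightarrow>
    measure lborel (Y \<inter> F) / measure lborel F"
proof -
  have m [measurable]: "F \<in> sets borel" "\<And>n. A n \<in> sets borel" "Y \<in> sets borel"
    using F Y A unfolding fundamental_domain_def by auto
  note Fm = fundamental_domain_measure[OF F L(1)]
  have fin: "emeasure lborel S < \<infinity>" if "S \<subseteq> A n" for S n
    using emeasure_mono[OF that, of lborel] A(2)[of n] by (auto intro: le_less_trans)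
  have finK: "emeasure lborel {y. y - k \<in> A n} < \<infinity>" for k n
    using emeasure_lborel_shift[OF A(1), of "- k" n] A(2) by simp
  define q where "q n k = measure lborel {a \<in> A n. a + k \<in> Y}" for n k
  \<comment> \<open>\<open>r n k\<close> is the proportion of \<open>A n\<close> covered by
    \<open>Y\<close> shifted by \<open>- k\<close>.\<close>
  define r where "r n k = q n k / measure lborel (A n)" for n k
  have q0: "q n 0 = measure lborel (Y \<inter> A n)" for n
    unfolding q_def by (rule arg_cong[where f = "measure lborel"]) auto
  have qshift: "q n k = measure lborel (Y \<inter> {y. y - k \<in> A n})" for n k
  proof -
    have "{a \<in> A n. a + k \<in> Y} = {a. a + k \<in> Y \<inter> {y. y - k \<in> A n}}" by auto
    then show ?thesis unfolding q_def measure_def by (simp only:) (subst emeasure_lborel_shift, auto)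
  qed
  have measure_le: "measure lborel S \<le> measure lborel S'"
    if "S \<subseteq> S'" "S' \<subseteq> A n \<union> {y. y - k \<in> A n}" "S \<in> sets borel" "S' \<in> sets borel" for S S' n k
  proof (rule measure_mono_fmeasurable[OF that(1)])
    have "A n \<in> fmeasurable lborel" "{y. y - k \<in> A n} \<in> fmeasurable lborel"
      using A(2)[of n] finK[of k n] by (auto intro: fmeasurableI)
    then show "S' \<in> fmeasurable lborel"
      using fmeasurableI2[OF fmeasurable.Un[of "A n" lborel "{y. y - k \<in> A n}"] that(2)] that(4) by simp
  qed (use that in simp)
  have q_up: "q n k \<le> q n 0 + measure lborel ({y. y - k \<in> A n} - A n)" for n k
  proof -
    have "q n k \<le> measure lborel ((Y \<inter> A n) \<union> ({y. y - k \<in> A n} - A n))"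
      unfolding qshift
      by (rule measure_le[where n = n and k = k]) auto
    also have "\<dots> \<le> measure lborel (Y \<inter> A n) + measure lborel ({y. y - k \<in> A n} - A n)"
      by (rule measure_Un_le) auto
    finally show ?thesis unfolding q0 .
  qed
  have q_low: "q n 0 \<le> q n k + measure lborel ({y. y - (- k) \<in> A n} - A n)" for n k
  proof -
    have "q n 0 \<le> measure lborel ((Y \<inter> {y. y - k \<in> A n}) \<union> (A n - {y. y - k \<in> A n}))"
      unfolding q0
      by (rule measure_le[where n = n and k = k]) auto
    also have "\<dots> \<le> measure lborel (Y \<inter> {y. y - k \<in> A n}) + measure lborel (A n - {y. y - k \<in> A n})"
      by (rule measure_Un_le) auto
    also have "measure lborel (A n - {y. y - k \<in> A n}) = measure lborel {y. y + k \<in> A n - {y. y - k \<in> A n}}"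
      unfolding measure_def by (subst emeasure_lborel_shift) auto
    also have "{y. y + k \<in> A n - {y. y - k \<in> A n}} = {y. y - (- k) \<in> A n} - A n" by auto
    finally show ?thesis unfolding qshift .
  qed
  have lim: "(\<lambda>n. r n k - r n 0) \<longlonglongrightarrow> 0" for k
  proof (rule Lim_null_comparison)
    have "norm (r n k - r n 0) \<le> measure lborel ({y. y - k \<in> A n} - A n) / measure lborel (A n) +
        measure lborel ({y. y - (- k) \<in> A n} - A n) / measure lborel (A n)" for n
    proof -
      have "\<bar>q n k - q n 0\<bar> \<le> measure lborel ({y. y - k \<in> A n} - A n) + measure lborel ({y. y - (- k) \<in> A n} - A n)"
        using q_up[of n k] q_low[of n k] measure_nonneg[of lborel "{y. y - k \<in> A n} - A n"]
          measure_nonneg[of lborel "{y. y - (- k) \<in> A n} - A n"] by linarith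
      then show ?thesis using A(3)[of n] unfolding r_def
        by (simp add: divide_right_mono flip: add_divide_distrib diff_divide_distrib)
    qed
    then show "\<forall>\<^sub>F n in sequentially. norm (r n k - r n 0) \<le>
        measure lborel ({y. y - k \<in> A n} - A n) / measure lborel (A n) +
        measure lborel ({y. y - (- k) \<in> A n} - A n) / measure lborel (A n)" by simp
    show "(\<lambda>n. measure lborel ({y. y - k \<in> A n} - A n) / measure lborel (A n) +
        measure lborel ({y. y - (- k) \<in> A n} - A n) / measure lborel (A n)) \<longlonglongrightarrow> 0"
      using tendsto_add[OF Foelner[of k] Foelner[of "- k"]] by simp
  qed
  have r01: "0 \<le> r n k" "r n k \<le> 1" for n k
  proof -
    have "q n k \<le> measure lborel (A n)" unfolding q_def
      by (rule measure_le[where n = n and k = k]) auto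
    then show "0 \<le> r n k" "r n k \<le> 1" unfolding r_def q_def using A(3)[of n] by auto
  qed
  have q_meas [measurable]: "q n \<in> borel_measurable borel" for n
  proof -
    have "(\<lambda>k. \<integral>\<^sup>+a. indicator (A n) a * indicator Y (a + k) \<partial>lborel) \<in> borel_measurable lborel"
      by measurable
    then show ?thesis unfolding q_def measure_def by (simp add: emeasure_pair_Collect)
  qed
  have r_meas [measurable]: "r n \<in> borel_measurable borel" for n
    unfolding r_def by measurable
  have int_F: "integrable lborel (indicator F :: _ \<Rightarrow> real)" using Fm(1) m(1) by simp
  have int: "integrable lborel (\<lambda>k. indicator F k * r n k)" for n
    by (rule Bochner_Integration.integrable_bound[OF int_F])
       (use r01 in \<open>auto split: split_indicator\<close>)
  have avg: "(\<integral>k. indicator F k * r n k \<partial>lborel) = measure lborel (Y \<inter> F)" for n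
  proof -
    have e: "ennreal (q n k) = emeasure lborel {a \<in> A n. a + k \<in> Y}" for k
    proof -
      have "emeasure lborel {a \<in> A n. a + k \<in> Y} < \<infinity>" by (rule fin[where n = n]) auto
      then show ?thesis unfolding q_def by (intro emeasure_eq_ennreal_measure[symmetric]) auto
    qed
    have "ennreal (\<integral>k. indicator F k * r n k \<partial>lborel) = (\<integral>\<^sup>+k. ennreal (indicator F k * r n k) \<partial>lborel)"
      by (rule nn_integral_eq_integral[symmetric, OF int]) (use r01 in auto)
    also have "\<dots> = (\<integral>\<^sup>+k. ennreal (inverse (measure lborel (A n))) * (indicator F k * emeasure lborel {a \<in> A n. a + k \<in> Y}) \<partial>lborel)"
      by (intro nn_integral_cong)
         (auto split: split_indicator simp: r_def divide_inverse mult.commute ennreal_mult'' simp flip: e)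
    also have "\<dots> = ennreal (inverse (measure lborel (A n))) *
        (\<integral>\<^sup>+k. indicator F k * emeasure lborel {a \<in> A n. a + k \<in> Y} \<partial>lborel)"
      by (rule nn_integral_cmult) (simp flip: e)
    also have "\<dots> = ennreal (inverse (measure lborel (A n))) * (emeasure lborel (A n) * emeasure lborel (Y \<inter> F))"
      by (subst average_over_fundamental_domain[OF F L Y A(1)]) simp
    also have "emeasure lborel (A n) = ennreal (measure lborel (A n))"
      using A(2)[of n] by (intro emeasure_eq_ennreal_measure) auto
    also have "emeasure lborel (Y \<inter> F) = ennreal (measure lborel (Y \<inter> F))"
    proof (rule emeasure_eq_ennreal_measure)
      have "emeasure lborel (Y \<inter> F) \<le> emeasure lborel F" by (intro emeasure_mono) auto
      then show "emeasure lborel (Y \<inter> F) \<noteq> \<top>" using Fm(1) by (auto simp: top_unique)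
    qed
    also have "ennreal (inverse (measure lborel (A n))) * (ennreal (measure lborel (A n)) * ennreal (measure lborel (Y \<inter> F)))
       = ennreal (measure lborel (Y \<inter> F))"
      using A(3)[of n] by (simp flip: ennreal_mult add: field_simps)
    finally show ?thesis using r01 by (subst (asm) ennreal_inj) (auto intro!: integral_nonneg_AE)
  qed
  \<comment> \<open>The integral of \<open>r n k\<close> over \<open>F\<close> is the same for every
    \<open>n\<close>. As \<open>r n k\<close> and \<open>r n 0\<close> approach each other for each
    \<open>k\<close>, with differences bounded by \<open>1\<close>, the numbers \<open>r n 0\<close>
    must converge to the mean over \<open>F\<close>.\<close>
  have "(\<lambda>n. \<integral>k. indicator F k * (r n k - r n 0) \<partial>lborel) \<longlonglongrightarrow> (\<integral>k. 0 \<partial>(lborel::(real^'n) measure))"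
  proof (rule integral_dominated_convergence[where w = "indicator F"])
    show "AE k in lborel. (\<lambda>n. indicator F k * (r n k - r n 0)) \<longlonglongrightarrow> 0"
      using tendsto_mult_right_zero[OF lim] by simp
    show "AE k in lborel. norm (indicator F k * (r n k - r n 0)) \<le> indicator F k" for n
    proof (rule AE_I2)
      fix k
      have "\<bar>r n k - r n 0\<bar> \<le> 1" using r01[of n k] r01[of n 0] by linarith
      then show "norm (indicator F k * (r n k - r n 0)) \<le> indicator F k" by (auto split: split_indicator)
    qed
  qed (use int_F in auto)
  moreover have "(\<integral>k. indicator F k * (r n k - r n 0) \<partial>lborel) = measure lborel (Y \<inter> F) - measure lborel F * r n 0" for n
  proof -
    have "(\<integral>k. indicator F k * (r n k - r n 0) \<partial>lborel) =
      (\<integral>k. indicator F k * r n k \<partial>lborel) - (\<integral>k. indicator F k * r n 0 \<partial>lborel)"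
      using int[of n] int_F by (simp add: right_diff_distrib)
    then show ?thesis using avg int_F by simp
  qed
  ultimately have "(\<lambda>n. measure lborel (Y \<inter> F) - measure lborel F * r n 0) \<longlonglongrightarrow> 0" by simp
  then have "(\<lambda>n. measure lborel (Y \<inter> F) - (measure lborel (Y \<inter> F) - measure lborel F * r n 0)) \<longlonglongrightarrow> measure lborel (Y \<inter> F) - 0"
    by (intro tendsto_intros)
  then have "(\<lambda>n. measure lborel F * r n 0 / measure lborel F) \<longlonglongrightarrow> measure lborel (Y \<inter> F) / measure lborel F"
    using Fm(2) by (intro tendsto_intros) auto
  then show ?thesis using Fm(2) unfolding r_def q0 by simp
qed

text \<open>A ball moved by \<open>k\<close> stays in the concentric ball enlarged by
  \<open>norm k\<close>, whose relative excess volume tends to \<open>0\<close>. The index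
  \<open>Suc n\<close> keeps the radius positive.\<close>

lemma periodic_density_ball:
  fixes Y :: "(real^'n::finite) set"
  assumes "fundamental_domain L F" "countable L" "int_submodule L" "Y \<in> sets borel" "periodic_set L Y"
  shows "(\<lambda>n. measure lborel (Y \<inter> ball 0 (real (Suc n))) / measure lborel (ball (0::real^'n) (real (Suc n)))) \<longlonglongrightarrow>
    measure lborel (Y \<inter> F) / measure lborel F"
proof (rule periodic_density[OF assms])
  let ?d = "DIM(real^'n)" and ?A = "\<lambda>n. ball (0::real^'n) (real (Suc n))"
  have vol: "measure lborel (ball (0::real^'n) r) = unit_ball_vol (real ?d) * r ^ ?d" if "r \<ge> 0" for r
    using content_ball[OF that, of "0::real^'n"] by simp
  have u: "unit_ball_vol (real ?d) > 0" by simp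
  show pos: "measure lborel (?A n) > 0" for n using u by (subst vol) auto
  show "emeasure lborel (?A n) < \<infinity>" for n
    by (rule emeasure_bounded_finite) simp
  show "(\<lambda>n. measure lborel ({y. y - k \<in> ?A n} - ?A n) / measure lborel (?A n)) \<longlonglongrightarrow> 0" for k :: "real^'n"
  proof (rule Lim_null_comparison)
    have "norm (measure lborel ({y. y - k \<in> ?A n} - ?A n) / measure lborel (?A n))
        \<le> (1 + norm k / real (Suc n)) ^ ?d - 1" for n
    proof -
      have sub: "?A n \<subseteq> ball 0 (real (Suc n) + norm k)" by (rule subset_ball) simp
      have "measure lborel ({y. y - k \<in> ?A n} - ?A n) \<le> measure lborel (ball 0 (real (Suc n) + norm k) - ?A n)"
      proof (rule measure_mono_fmeasurable)
        show "{y. y - k \<in> ?A n} - ?A n \<subseteq> ball 0 (real (Suc n) + norm k) - ?A n"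
        proof (clarsimp)
          fix x :: "real^'n" assume "norm (x - k) < 1 + real n"
          then show "norm x < 1 + real n + norm k" using norm_triangle_ineq[of "x - k" k] by simp
        qed
        have "(\<lambda>y. y - k) \<in> borel_measurable borel" by simp
        from measurable_sets[OF this, of "?A n"] show "{y. y - k \<in> ?A n} - ?A n \<in> sets lborel"
          by (simp add: vimage_def)
        have "emeasure lborel (ball 0 (real (Suc n) + norm k) - ?A n) < \<infinity>"
          by (intro emeasure_bounded_finite bounded_diff) simp
        then show "ball 0 (real (Suc n) + norm k) - ?A n \<in> fmeasurable lborel"
          by (intro fmeasurableI) auto
      qed
      also have "\<dots> = measure lborel (ball (0::real^'n) (real (Suc n) + norm k)) - measure lborel (?A n)"
      proof (rule measure_Diff[OF _ _ _ sub])
        have "emeasure lborel (ball (0::real^'n) (real (Suc n) + norm k)) < \<infinity>"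
          by (rule emeasure_bounded_finite) simp
        then show "emeasure lborel (ball (0::real^'n) (real (Suc n) + norm k)) \<noteq> \<infinity>" by simp
      qed auto
      finally have "measure lborel ({y. y - k \<in> ?A n} - ?A n) / measure lborel (?A n) \<le>
          (measure lborel (ball (0::real^'n) (real (Suc n) + norm k)) - measure lborel (?A n)) / measure lborel (?A n)"
        by (intro divide_right_mono) auto
      also have "\<dots> = ((real (Suc n) + norm k) / real (Suc n)) ^ ?d - 1"
      proof -
        have "(u * x - u * y) / (u * y) = x / y - 1" if "u > 0" "y > 0" for u x y :: real
          using that by (simp add: field_simps)
        from this[OF u, of "real (Suc n) ^ ?d" "(real (Suc n) + norm k) ^ ?d"]
        show ?thesis by (simp only: vol[OF of_nat_0_le_iff] vol[OF add_nonneg_nonneg[OF of_nat_0_le_iff norm_ge_zero]] power_divide) simp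
      qed
      also have "(real (Suc n) + norm k) / real (Suc n) = 1 + norm k / real (Suc n)" by (simp add: field_simps)
      finally show ?thesis by simp
    qed
    then show "\<forall>\<^sub>F n in sequentially. norm (measure lborel ({y. y - k \<in> ?A n} - ?A n) / measure lborel (?A n))
        \<le> (1 + norm k / real (Suc n)) ^ ?d - 1" by simp
    have "(\<lambda>n. norm k / real (Suc n)) \<longlonglongrightarrow> 0" by (rule LIMSEQ_Suc) (rule lim_const_over_n)
    then have "(\<lambda>n. (1 + norm k / real (Suc n)) ^ ?d - 1) \<longlonglongrightarrow> (1 + 0) ^ ?d - 1" by (intro tendsto_intros)
    then show "(\<lambda>n. (1 + norm k / real (Suc n)) ^ ?d - 1) \<longlonglongrightarrow> 0" by simp
  qed
qed auto

text \<open>Uniqueness of Haar measure: with \<open>B\<close> the unit ball, Fubini gives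
  \<open>\<lambda>(B) \<lambda>(f S) = \<lambda>(S) \<lambda>(f B)\<close>. The determinant formula of the library needs a
  well-ordered index type.\<close>

lemma emeasure_linear_image:
  fixes f :: "real^'n::finite \<Rightarrow> real^'n"
  assumes f: "linear f" "bij f"
  obtains c where "c > 0" "\<And>S. S \<in> sets borel \<Longrightarrow> emeasure lborel (f ` S) = ennreal c * emeasure lborel S"
proof -
  define g where "g = inv f"
  note H = linear_bij_homeo[OF f]
  have fg: "f (g y) = y" "g (f y) = y" for y unfolding g_def using f by (auto simp: bij_is_surj surj_f_inv_f bij_is_inj)
  have g_meas [measurable]: "g \<in> borel_measurable borel" unfolding g_def by (rule H(6))
  interpret f: linear f by (rule f)
  interpret g: linear g unfolding g_def by (rule H(1))
  have im: "y \<in> f ` S \<longleftrightarrow> g y \<in> S" for y S using fg by (metis imageE imageI)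
  define B where "B = ball (0::real^'n) 1"
  have B [measurable]: "B \<in> sets borel" unfolding B_def by simp
  have key: "emeasure lborel B * emeasure lborel (f ` S) = emeasure lborel S * emeasure lborel (f ` B)"
    if S [measurable]: "S \<in> sets borel" for S
  proof -
    have "emeasure lborel B * emeasure lborel (f ` S) = (\<integral>\<^sup>+x. indicator B x * emeasure lborel (f ` S) \<partial>lborel)"
      by (simp add: nn_integral_multc)
    also have "\<dots> = (\<integral>\<^sup>+x. (\<integral>\<^sup>+y. indicator B x * indicator S (x + g y) \<partial>lborel) \<partial>lborel)"
    proof (rule nn_integral_cong)
      fix x
      have "(\<integral>\<^sup>+y. indicator S (x + g y) \<partial>lborel) = (\<integral>\<^sup>+y. indicator {y. y + f x \<in> f ` S} y \<partial>lborel)"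
        by (intro nn_integral_cong) (auto simp: im g.add fg add.commute split: split_indicator)
      also have "\<dots> = emeasure lborel {y. y + f x \<in> f ` S}"
        by (rule nn_integral_indicator) (simp add: im, measurable)
      also have "\<dots> = emeasure lborel (f ` S)" using H(7)[OF S] by (rule emeasure_lborel_shift)
      finally show "indicator B x * emeasure lborel (f ` S) = (\<integral>\<^sup>+y. indicator B x * indicator S (x + g y) \<partial>lborel)"
        by (simp add: nn_integral_cmult)
    qed
    also have "\<dots> = (\<integral>\<^sup>+y. (\<integral>\<^sup>+x. indicator B x * indicator S (x + g y) \<partial>lborel) \<partial>lborel)"
      by (rule lborel_pair.Fubini'[symmetric]) measurable
    also have "\<dots> = (\<integral>\<^sup>+y. (\<integral>\<^sup>+x. indicator B (x - g y) * indicator S x \<partial>lborel) \<partial>lborel)"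
    proof (rule nn_integral_cong)
      fix y
      have "(\<integral>\<^sup>+x. indicator B (x - g y) * indicator S x \<partial>lborel) =
          (\<integral>\<^sup>+x. indicator B (x - g y) * indicator S x \<partial>distr lborel borel ((+) (g y)))"
        by (simp add: lborel_distr_plus)
      also have "\<dots> = (\<integral>\<^sup>+x. indicator B x * indicator S (x + g y) \<partial>lborel)"
        by (subst nn_integral_distr) (auto simp: add.commute)
      finally show "(\<integral>\<^sup>+x. indicator B x * indicator S (x + g y) \<partial>lborel) =
        (\<integral>\<^sup>+x. indicator B (x - g y) * indicator S x \<partial>lborel)" by simp
    qed
    also have "\<dots> = (\<integral>\<^sup>+x. (\<integral>\<^sup>+y. indicator B (x - g y) * indicator S x \<partial>lborel) \<partial>lborel)"
      by (rule lborel_pair.Fubini') measurable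
    also have "\<dots> = (\<integral>\<^sup>+x. indicator S x * emeasure lborel (f ` B) \<partial>lborel)"
    proof (rule nn_integral_cong)
      fix x
      \<comment> \<open>The unit ball is symmetric, so \<open>x - g y\<close> may be replaced by
        \<open>g y - x\<close>; hence \<open>y\<close> ranges over a translate of the image of
        \<open>B\<close>.\<close>
      have "(\<integral>\<^sup>+y. indicator B (x - g y) \<partial>lborel) = (\<integral>\<^sup>+y. indicator {y. y + (- f x) \<in> f ` B} y \<partial>lborel)"
        by (intro nn_integral_cong)
           (auto simp: im g.diff fg B_def dist_norm norm_minus_commute split: split_indicator)
      also have "\<dots> = emeasure lborel {y. y + (- f x) \<in> f ` B}"
        by (rule nn_integral_indicator) (simp add: im, measurable)
      also have "\<dots> = emeasure lborel (f ` B)" using H(7)[OF B] by (rule emeasure_lborel_shift)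
      finally show "(\<integral>\<^sup>+y. indicator B (x - g y) * indicator S x \<partial>lborel) = indicator S x * emeasure lborel (f ` B)"
        by (subst nn_integral_multc) (auto simp: mult.commute)
    qed
    also have "\<dots> = emeasure lborel S * emeasure lborel (f ` B)" by (simp add: nn_integral_multc)
    finally show ?thesis .
  qed
  have pos: "emeasure lborel S > 0" "emeasure lborel S < \<infinity>" if "open S" "S \<noteq> {}" "bounded S" for S :: "(real^'n) set"
    using emeasure_bounded_finite[OF that(3)] open_not_negligible[OF that(1,2)] that(1)
    by (auto simp: negligible_iff_emeasure0 zero_less_iff_neq_zero)
  have "f ` B = g -` B" using im by auto
  moreover have "open (g -` B)"
    using H(4)[of UNIV] unfolding B_def g_def by (intro open_vimage) auto
  ultimately have "open (f ` B)" by simp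
  moreover have "bounded (f ` B)"
    using f bounded_linear_image linear_conv_bounded_linear unfolding B_def by blast
  ultimately have fB: "emeasure lborel (f ` B) > 0" "emeasure lborel (f ` B) < \<infinity>"
    using pos[of "f ` B"] by (auto simp: B_def)
  have Bp: "emeasure lborel B > 0" "emeasure lborel B < \<infinity>" using pos[of B] by (auto simp: B_def)
  define c where "c = measure lborel (f ` B) / measure lborel B"
  have eB: "emeasure lborel B = ennreal (measure lborel B)" "emeasure lborel (f ` B) = ennreal (measure lborel (f ` B))"
    using fB Bp by (auto intro!: emeasure_eq_ennreal_measure)
  have mp: "measure lborel B > 0" "measure lborel (f ` B) > 0"
    using fB Bp unfolding eB by (simp_all only: ennreal_less_zero_iff)
  have "emeasure lborel (f ` S) = ennreal c * emeasure lborel S" if S: "S \<in> sets borel" for S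
  proof -
    have "ennreal (inverse (measure lborel B)) * (emeasure lborel B * emeasure lborel (f ` S)) =
      ennreal (inverse (measure lborel B)) * (emeasure lborel S * emeasure lborel (f ` B))"
      using key[OF S] by simp
    moreover have "ennreal (inverse (measure lborel B)) * emeasure lborel B = 1"
      unfolding eB using mp by (simp flip: ennreal_mult)
    moreover have "ennreal (inverse (measure lborel B)) * emeasure lborel (f ` B) = ennreal c"
      unfolding eB c_def using mp by (simp add: divide_inverse mult.commute flip: ennreal_mult)
    ultimately show ?thesis by (metis (no_types, opaque_lifting) mult.assoc mult.commute mult.right_neutral)
  qed
  moreover have "c > 0" unfolding c_def using mp by simp
  ultimately show ?thesis using that by blast
qed

text \<open>The factor by which \<open>f\<close> scales volume cancels, so a periodic set and its
  linear image have the same density.\<close>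

lemma measure_ratio_linear_image:
  fixes f :: "real^'n::finite \<Rightarrow> real^'n"
  assumes f: "linear f" "bij f" and m: "Y \<in> sets borel" "F \<in> sets borel"
  shows "measure lborel (f ` Y \<inter> f ` F) / measure lborel (f ` F) = measure lborel (Y \<inter> F) / measure lborel F"
proof -
  obtain c where c: "c > 0" "\<And>S. S \<in> sets borel \<Longrightarrow> emeasure lborel (f ` S) = ennreal c * emeasure lborel S"
    using emeasure_linear_image[OF f] by blast
  have "measure lborel (f ` S) = c * measure lborel S" if "S \<in> sets borel" for S
    unfolding measure_def using c(1) c(2)[OF that] by (simp add: enn2real_mult)
  moreover have "f ` Y \<inter> f ` F = f ` (Y \<inter> F)" using f by (simp add: image_Int bij_is_inj)
  ultimately show ?thesis using c(1) m by simp
qed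

subsection \<open>Expanding matrices\<close>

text \<open>Serves to remove one root of an annihilating polynomial: \<open>c\<close> will be the
  modulus of the root, and \<open>w\<close> the iterates already known to vanish in the
  limit.\<close>

lemma linear_recurrence_tendsto_zero:
  fixes u w :: "nat \<Rightarrow> 'a::real_normed_vector"
  assumes rec: "\<And>n. norm (u (Suc n)) \<le> c * norm (u n) + norm (w n)" and c: "0 \<le> c" "c < 1"
    and w: "w \<longlonglongrightarrow> 0"
  shows "u \<longlonglongrightarrow> 0"
proof (rule LIMSEQ_I)
  fix e :: real assume e: "e > 0"
  \<comment> \<open>This choice makes \<open>e / 2\<close> the fixed point of the map sending
    \<open>x\<close> to \<open>c * x + d\<close>.\<close>
  define d where "d = e / 2 * (1 - c)"
  have d: "d > 0" unfolding d_def using e c by simp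
  obtain N where N: "\<And>n. n \<ge> N \<Longrightarrow> norm (w n) < d" using LIMSEQ_D[OF w d] by auto
  have bnd: "norm (u (N + k)) \<le> c ^ k * norm (u N) + e / 2" for k
  proof (induction k)
    case 0 then show ?case using e by simp
  next
    case (Suc k)
    have "norm (u (N + Suc k)) \<le> c * norm (u (N + k)) + d"
      using rec[of "N + k"] N[of "N + k"] by simp
    also have "\<dots> \<le> c * (c ^ k * norm (u N) + e / 2) + d"
      using mult_left_mono[OF Suc c(1)] by simp
    also have "\<dots> = c ^ Suc k * norm (u N) + e / 2" by (simp add: d_def field_simps)
    finally show ?case .
  qed
  have "(\<lambda>k. c ^ k * norm (u N)) \<longlonglongrightarrow> 0"
    using c by (intro tendsto_mult_left_zero LIMSEQ_power_zero) simp
  from LIMSEQ_D[OF this, of "e / 2"] e obtain M where M: "\<And>k. k \<ge> M \<Longrightarrow> c ^ k * norm (u N) < e / 2"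
    by auto (metis abs_le_D1 abs_of_nonneg c(1) mult_nonneg_nonneg norm_ge_zero zero_le_power)
  have "norm (u n - 0) < e" if n: "n \<ge> N + M" for n
  proof -
    have "N \<le> n" "n - N \<ge> M" using n by auto
    then show ?thesis using bnd[of "n - N"] M[of "n - N"] by simp
  qed
  then show "\<exists>no. \<forall>n\<ge>no. norm (u n - 0) < e" by blast
qed

section \<open>Complexification and polynomials in a matrix\<close>

definition cvec :: "real^'n \<Rightarrow> complex^'n" where "cvec v = (\<chi> i. complex_of_real (v $ i))"
definition cmat :: "real^'n^'m \<Rightarrow> complex^'n^'m" where "cmat Q = (\<chi> i j. complex_of_real (Q $ i $ j))"

lemma cvec_simps:
  fixes Q :: "real^'n^'n::finite"
  shows "cvec (Q *v v) = cmat Q *v cvec v" "cvec v = 0 \<longleftrightarrow> v = 0"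
    "cmat P ** cmat Q = cmat (P ** Q)" "cmat (mat 1 :: real^'n^'n) = mat 1"
    "norm (cvec v) = norm v"
  by (simp_all add: cvec_def cmat_def vec_eq_iff matrix_vector_mult_def matrix_matrix_mult_def
      mat_def norm_vec_def)

lemma complex_eigenvalue_iff:
  "complex_eigenvalue Q c \<longleftrightarrow> (\<exists>v. v \<noteq> 0 \<and> cmat Q *v v = c *s v)"
  by (simp add: complex_eigenvalue_def cmat_def vec_eq_iff matrix_vector_mult_def)

text \<open>This is \<open>p(A) v\<close> in Horner form. Acting on a single vector suffices, so
  powers of the matrix are never formed.\<close>

definition poly_act :: "complex^'n^'n \<Rightarrow> complex poly \<Rightarrow> complex^'n \<Rightarrow> complex^'n" where
  "poly_act A p v = fold_coeffs (\<lambda>c w. c *s v + A *v w) p 0"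

lemma poly_act_0 [simp]: "poly_act A 0 v = 0"
  by (simp add: poly_act_def)

lemma poly_act_pCons [simp]: "poly_act A (pCons c p) v = c *s v + A *v poly_act A p v"
  for A :: "complex^'n^'n::finite"
  by (cases "p = 0 \<and> c = 0") (auto simp: poly_act_def matrix_vector_mult_0_right)

lemma poly_act_add: "poly_act A (p + q) v = poly_act A p v + poly_act A q v"
  for A :: "complex^'n^'n::finite"
  by (induction p q rule: poly_induct2) (simp_all add: matrix_vector_right_distrib vec.scale_left_distrib)

lemma poly_act_smult: "poly_act A (smult c p) v = c *s poly_act A p v"
  for A :: "complex^'n^'n::finite"
  by (induction p) (simp_all add: vec.scale_right_distrib vector_scalar_commute)

text \<open>\<open>p(A)\<close> commutes with \<open>A - c\<close>, which lets a linear factor be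
  moved from the polynomial to the vector.\<close>

lemma poly_act_vec: "poly_act A p (A *v v - c *s v) = A *v poly_act A p v - c *s poly_act A p v"
  for A :: "complex^'n^'n::finite"
proof (induction p)
  case (pCons a p)
  then show ?case
    by (simp add: matrix_vector_right_distrib matrix_vector_mult_diff_distrib vector_scalar_commute vec.scale_right_distrib
        vec.scale_right_diff_distrib mult.commute)
qed (simp add: matrix_vector_mult_0_right)

lemma poly_act_linear_factor:
  "poly_act A ([:- c, 1:] * p) v = A *v poly_act A p v - c *s poly_act A p v"
  for A :: "complex^'n^'n::finite"
proof -
  have "[:- c, 1:] * p = smult (- c) p + pCons 0 p" by (simp add: mult_pCons_left)
  then show ?thesis unfolding poly_act_add by (simp only: poly_act_add poly_act_smult) simp
qed

lemma poly_act_monom: "poly_act A (monom c i) v = c *s ((*v) A ^^ i) v"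
  for A :: "complex^'n^'n::finite"
  by (induction i) (simp_all add: monom_0 monom_Suc matrix_vector_mult_0_right vector_scalar_commute)

lemma poly_act_sum: "poly_act A (\<Sum>i\<in>I. f i) v = (\<Sum>i\<in>I. poly_act A (f i) v)"
  for A :: "complex^'n^'n::finite"
  by (induction I rule: infinite_finite_induct) (simp_all add: poly_act_add)

text \<open>A list of iterates of \<open>v\<close> longer than the real dimension is linearly
  dependent, already with real coefficients.\<close>

lemma annihilating_polynomial:
  fixes A :: "complex^'n^'n::finite"
  obtains p where "p \<noteq> 0" "poly_act A p v = 0"
proof (cases "inj_on (\<lambda>i. ((*v) A ^^ i) v) {..DIM(complex^'n)}")
  \<comment> \<open>Coinciding iterates would collapse in a set and hide the dependence, so they get
    a polynomial of their own.\<close>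
  case False
  then obtain i j where ij: "i \<noteq> j" "((*v) A ^^ i) v = ((*v) A ^^ j) v" unfolding inj_on_def by blast
  let ?p = "monom 1 i + monom (-1) j :: complex poly"
  have "coeff ?p i = 1" using ij(1) by simp
  then have "?p \<noteq> 0" by (metis coeff_0 zero_neq_one)
  moreover have "poly_act A ?p v = 0" using ij(2) by (simp add: poly_act_add poly_act_monom)
  ultimately show ?thesis using that by blast
next
  case True
  define u where "u i = ((*v) A ^^ i) v" for i
  define U where "U = u ` {..DIM(complex^'n)}"
  have inj: "inj_on u {..DIM(complex^'n)}" using True unfolding u_def .
  have "card U > DIM(complex^'n)" unfolding U_def using card_image[OF inj] by simp
  then have "dependent U" using independent_bound[of U] by (meson not_less)
  moreover have "finite U" unfolding U_def by simp
  ultimately obtain c where c: "(\<Sum>x\<in>U. c x *\<^sub>R x) = 0" "\<exists>x\<in>U. c x \<noteq> 0"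
    using dependent_finite by blast
  let ?p = "\<Sum>i\<le>DIM(complex^'n). monom (complex_of_real (c (u i))) i"
  obtain k where k: "k \<le> DIM(complex^'n)" "c (u k) \<noteq> 0" using c(2) unfolding U_def by auto
  have "coeff ?p k = complex_of_real (c (u k))" using k(1) by (simp add: coeff_sum)
  then have "?p \<noteq> 0" using k(2) by (metis coeff_0 of_real_eq_0_iff)
  moreover have "poly_act A ?p v = 0"
  proof -
    have "poly_act A ?p v = (\<Sum>i\<le>DIM(complex^'n). c (u i) *\<^sub>R u i)"
      by (simp add: poly_act_sum poly_act_monom u_def vec_eq_iff scaleR_conv_of_real[where 'a=complex])
    also have "\<dots> = (\<Sum>x\<in>U. c x *\<^sub>R x)" unfolding U_def by (subst sum.reindex[OF inj]) simp
    finally show ?thesis using c(1) by simp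
  qed
  ultimately show ?thesis using that by blast
qed

lemma vec_norm_scale: "norm (c *s v) = cmod c * norm v" for v :: "complex^'n::finite"
proof -
  have "(\<lambda>i. cmod c * norm (v $ i)) = (\<lambda>i. norm ((c *s v) $ i))" by (simp add: norm_mult)
  then show ?thesis unfolding norm_vec_def by (metis L2_set_right_distrib norm_ge_zero)
qed

text \<open>Induction on the degree, with \<open>p = (X - c) q\<close>. If \<open>c\<close> has
  modulus below \<open>1\<close>, then \<open>q\<close> annihilates \<open>w = A v - c v\<close>, so
  the iterates of \<open>w\<close> vanish in the limit and those of \<open>v\<close> satisfy a
  contracting recurrence perturbed by them. Otherwise \<open>c\<close> is no eigenvalue, so
  \<open>q(A) v\<close>, which lies in the kernel of \<open>A - c\<close>, is zero and
  \<open>q\<close> already annihilates \<open>v\<close>.\<close>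

lemma iterates_tendsto_zero:
  fixes A :: "complex^'n^'n::finite"
  assumes ev: "\<And>c v. v \<noteq> 0 \<Longrightarrow> A *v v = c *s v \<Longrightarrow> cmod c < 1"
    and "p \<noteq> 0" "poly_act A p v = 0"
  shows "(\<lambda>n. ((*v) A ^^ n) v) \<longlonglongrightarrow> 0"
  using assms(2,3)
proof (induction "degree p" arbitrary: p v)
  case 0
  then obtain c where "p = [:c:]" using degree_eq_zeroE by metis
  then have "v = 0" using 0 by (simp add: matrix_vector_mult_0_right)
  then have "((*v) A ^^ n) v = 0" for n by (induction n) (simp_all add: matrix_vector_mult_0_right)
  then show ?case by simp
next
  case (Suc d)
  have "\<not> constant (poly p)" using Suc(2) constant_degree by (metis nat.distinct(1))
  then obtain c where "poly p c = 0" using fundamental_theorem_of_algebra by blast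
  then obtain q where q: "p = [:- c, 1:] * q" using poly_eq_0_iff_dvd dvdE by metis
  have q0: "q \<noteq> 0" using q Suc(3) by auto
  have dq: "d = degree q"
    using Suc(2) q0 unfolding q by (subst (asm) degree_mult_eq) auto
  have z: "A *v poly_act A q v - c *s poly_act A q v = 0"
    using Suc(4) unfolding q poly_act_linear_factor .
  show ?case
  proof (cases "cmod c < 1")
    case True
    define w where "w = A *v v - c *s v"
    have "(\<lambda>n. ((*v) A ^^ n) w) \<longlonglongrightarrow> 0"
      using Suc(1)[OF dq q0, of w] z unfolding w_def poly_act_vec by blast
    then show ?thesis
    proof (rule linear_recurrence_tendsto_zero[where c = "cmod c", rotated 3])
      have step: "((*v) A ^^ Suc n) v = c *s ((*v) A ^^ n) v + ((*v) A ^^ n) w" for n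
        by (induction n) (simp_all add: w_def matrix_vector_right_distrib vector_scalar_commute)
      then show "norm (((*v) A ^^ Suc n) v) \<le> cmod c * norm (((*v) A ^^ n) v) + norm (((*v) A ^^ n) w)" for n
        unfolding step using norm_triangle_ineq[of "c *s ((*v) A ^^ n) v" "((*v) A ^^ n) w"] by (simp add: vec_norm_scale)
    qed (use True in auto)
  next
    case False
    then have "poly_act A q v = 0" using ev[of "poly_act A q v" c] z by auto
    then show ?thesis using Suc(1)[OF dq q0] by blast
  qed
qed

lemma expanding_invertible:
  fixes Q :: "real^'n^'n::finite"
  assumes "expanding Q" shows "invertible Q"
proof -
  have "v = 0" if "Q *v v = 0" for v
  proof (rule ccontr)
    assume "v \<noteq> 0"
    moreover have "cmat Q *v cvec v = 0 *s cvec v" using that by (simp flip: cvec_simps(1)) (simp add: cvec_simps(2))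
    ultimately have "complex_eigenvalue Q 0" unfolding complex_eigenvalue_iff using cvec_simps(2) by blast
    then show False using assms unfolding expanding_def by fastforce
  qed
  then show ?thesis using matrix_left_invertible_ker invertible_left_inverse by blast
qed

text \<open>The eigenvalues of the inverse are reciprocals of those of \<open>Q\<close>, hence of
  modulus below \<open>1\<close>.\<close>

lemma expanding_inverse_tendsto_zero:
  fixes Q :: "real^'n^'n::finite"
  assumes "expanding Q"
  shows "bij ((*v) Q)" "(\<lambda>n. (inv ((*v) Q) ^^ n) v) \<longlonglongrightarrow> 0"
proof -
  obtain A where inv: "A ** Q = mat 1" "Q ** A = mat 1"
    using expanding_invertible[OF assms] unfolding invertible_def by blast
  show "bij ((*v) Q)"
    by (rule o_bij[where g = "(*v) A"]) (auto simp: matrix_vector_mul_assoc inv o_def)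
  have A_eq: "inv ((*v) Q) = (*v) A"
    by (rule inv_unique_comp) (auto simp: matrix_vector_mul_assoc inv o_def)
  have ev: "cmod c < 1" if v: "v \<noteq> 0" "cmat A *v v = c *s v" for c v
  proof -
    have "v = cmat Q *v (cmat A *v v)"
      by (simp add: matrix_vector_mul_assoc cvec_simps(3,4) inv)
    then have e: "v = c *s (cmat Q *v v)" unfolding v(2) by (simp add: vector_scalar_commute)
    then have c: "c \<noteq> 0" using v(1) by auto
    have "inverse c *s v = cmat Q *v v" by (subst e) (simp add: c)
    then have "complex_eigenvalue Q (inverse c)" unfolding complex_eigenvalue_iff using v(1) by metis
    then have "cmod (inverse c) > 1" using assms unfolding expanding_def by blast
    then show ?thesis using c by (simp add: inverse_eq_divide norm_divide less_divide_eq split: if_splits)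
  qed
  obtain p where "p \<noteq> 0" "poly_act (cmat A) p (cvec v) = 0" using annihilating_polynomial by blast
  then have "(\<lambda>n. ((*v) (cmat A) ^^ n) (cvec v)) \<longlonglongrightarrow> 0"
    by (rule iterates_tendsto_zero[rotated]) (rule ev)
  moreover have "((*v) (cmat A) ^^ n) (cvec v) = cvec (((*v) A ^^ n) v)" for n
    by (induction n) (simp_all add: cvec_simps(1))
  ultimately have "(\<lambda>n. cvec (((*v) A ^^ n) v)) \<longlonglongrightarrow> 0" by simp
  then have "(\<lambda>n. norm (cvec (((*v) A ^^ n) v))) \<longlonglongrightarrow> 0" by (rule tendsto_norm_zero)
  then show "(\<lambda>n. (inv ((*v) Q) ^^ n) v) \<longlonglongrightarrow> 0"
    unfolding cvec_simps(5) A_eq by (rule tendsto_norm_zero_cancel)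
qed

subsection \<open>Ergodicity of expanding torus endomorphisms\<close>

lemma periodic_null:
  fixes Y :: "(real^'n::finite) set"
  assumes F: "fundamental_domain L F" and L: "countable L"
    and Y: "Y \<in> sets borel" "periodic_set L Y" and null: "emeasure lborel (Y \<inter> F) = 0"
  shows "Y \<in> null_sets lborel"
proof -
  have m [measurable]: "F \<in> sets borel" "Y \<in> sets borel"
    using F Y unfolding fundamental_domain_def by auto
  have "{y. y + (- x) \<in> Y \<inter> F} \<in> null_sets lborel" for x
    using emeasure_lborel_shift[of "Y \<inter> F" "- x"] null by (intro null_setsI) (simp, measurable)
  then have "(\<Union>x\<in>L. {y. y + (- x) \<in> Y \<inter> F}) \<in> null_sets lborel"
    by (intro null_sets_UN' L)
  moreover have "Y \<subseteq> (\<Union>x\<in>L. {y. y + (- x) \<in> Y \<inter> F})"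
  proof
    fix y assume y: "y \<in> Y"
    obtain x where x: "x \<in> L" "y - x \<in> F" using F unfolding fundamental_domain_def by metis
    have "y - x + x \<in> Y \<longleftrightarrow> y - x \<in> Y" using Y(2) x(1) unfolding periodic_set_def by blast
    then show "y \<in> (\<Union>x\<in>L. {y. y + (- x) \<in> Y \<inter> F})" using x y by auto
  qed
  ultimately show ?thesis using null_sets_subset Y(1) by (metis sets_lborel)
qed

text \<open>Only the van Hove condition for one-point sets \<open>K\<close> is used. For infinite \<open>K\<close> the set
  \<open>vH_boundary K (A n)\<close> may fail to be measurable or have infinite measure, and then
  \<^const>\<open>measure\<close> is \<open>0\<close> and the condition says nothing.\<close>

lemma van_Hove_periodic_density:
  fixes Y :: "(real^'n::finite) set" and A :: "nat \<Rightarrow> (real^'n) set"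
  assumes A: "van_Hove A"
    and F: "fundamental_domain L F" and L: "countable L" "int_submodule L"
    and Y: "Y \<in> sets borel" "periodic_set L Y"
  shows "(\<lambda>n. measure lebesgue (Y \<inter> A n) / measure lebesgue (A n)) \<longlonglongrightarrow>
    measure lborel (Y \<inter> F) / measure lborel F"
proof -
  \<comment> \<open>A Lebesgue set is a Borel set up to a null set; the density result is applied to
    the Borel parts \<open>B n\<close>.\<close>
  define B where "B n = main_part lborel (A n)" for n
  define N where "N n = null_part lborel (A n)" for n
  have A_meas: "A n \<in> sets lebesgue" and A_em: "0 < emeasure lebesgue (A n)" "emeasure lebesgue (A n) < \<infinity>" for n
    using A unfolding van_Hove_def by blast+
  have A_fin: "A n \<in> lmeasurable" for n using A_meas A_em by (intro fmeasurableI) auto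
  have A_pos: "measure lebesgue (A n) > 0" for n
    unfolding measure_def enn2real_positive_iff using A_em[of n] by (simp only: infinity_ennreal_def)
  have AB: "A n = B n \<union> N n" and N: "N n \<in> null_sets lebesgue" and B: "B n \<in> sets borel" for n
    using main_part_null_part_Un[OF A_meas[of n]] null_part_null_sets[OF A_meas[of n]]
      main_part_sets[OF A_meas[of n]]
    unfolding B_def N_def by auto
  have Bleb: "B n \<in> sets lebesgue" for n using B by simp
  have meas_int: "measure lebesgue (S \<inter> A n) = measure lborel (S \<inter> B n)" if "S \<in> sets borel" for S n
  proof -
    have "S \<inter> A n = (S \<inter> B n) \<union> (S \<inter> N n)" using AB[of n] by auto
    moreover have "S \<inter> N n \<in> null_sets lebesgue" using N that by (simp add: null_set_Int1)
    moreover have "S \<inter> B n \<in> sets borel" using that B by auto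
    ultimately show ?thesis using measure_Un_null_set[of "S \<inter> B n" lebesgue "S \<inter> N n"] by simp
  qed
  have measA: "measure lebesgue (A n) = measure lborel (B n)" for n
    using meas_int[of UNIV n] by simp
  have "(\<lambda>n. measure lborel ({y. y - k \<in> B n} - B n) / measure lborel (B n)) \<longlonglongrightarrow> 0" for k
  proof (rule Lim_null_comparison)
    show "(\<lambda>n. measure lebesgue (vH_boundary {k} (A n)) / measure lebesgue (A n)) \<longlonglongrightarrow> 0"
      using A unfolding van_Hove_def by simp
    have "norm (measure lborel ({y. y - k \<in> B n} - B n) / measure lborel (B n))
        \<le> measure lebesgue (vH_boundary {k} (A n)) / measure lebesgue (A n)" for n
    proof -
      have msum_eq: "msum {c} S = (+) c ` S" for c :: "real^'n" and S unfolding msum_def by auto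
      have vH: "vH_boundary {k} (A n) = ((+) k ` A n - interior (A n)) \<union> ((+) (- k) ` closure (- A n) \<inter> A n)"
        unfolding vH_boundary_def by (simp add: msum_eq)
      have vH_meas: "vH_boundary {k} (A n) \<in> lmeasurable"
        unfolding vH
      proof (rule fmeasurable.Un)
        show "(+) k ` A n - interior (A n) \<in> lmeasurable"
        proof (rule fmeasurableI2)
          show "(+) k ` A n \<in> lmeasurable" by (rule measurable_translation[OF A_fin])
          then have "(+) k ` A n \<in> sets lebesgue" by auto
          then show "(+) k ` A n - interior (A n) \<in> sets lebesgue" by (intro sets.Diff) auto
        qed auto
        show "(+) (- k) ` closure (- A n) \<inter> A n \<in> lmeasurable"
        proof (rule fmeasurableI2[OF A_fin])
          have "closed ((+) (- k) ` closure (- A n))" by (rule closed_translation) simp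
          then show "(+) (- k) ` closure (- A n) \<inter> A n \<in> sets lebesgue"
            using A_meas by (intro sets.Int) (auto simp: lebesgue_closedin)
        qed auto
      qed
      have [measurable]: "B n \<in> sets borel" by (rule B)
      \<comment> \<open>A point of \<open>B n\<close> moved by \<open>k\<close> that leaves
        \<open>B n\<close> either falls into the null part of \<open>A n\<close> or leaves
        \<open>A n\<close> altogether. In the second case it lies in the outer half of the van Hove
        boundary.\<close>
      have "{y. y - k \<in> B n} - B n \<subseteq> vH_boundary {k} (A n) \<union> N n"
      proof
        fix y assume y: "y \<in> {y. y - k \<in> B n} - B n"
        show "y \<in> vH_boundary {k} (A n) \<union> N n"
        proof (cases "y \<in> A n")
          case True then show ?thesis using y AB[of n] by auto
        next
          case False
          have "y = k + (y - k)" "y - k \<in> A n" using y AB[of n] by auto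
          then have "y \<in> (+) k ` A n" by blast
          then show ?thesis unfolding vH using False interior_subset by blast
        qed
      qed
      moreover have "{y. y - k \<in> B n} - B n \<in> sets borel" by measurable
      moreover have "vH_boundary {k} (A n) \<union> N n \<in> lmeasurable"
        using vH_meas N[of n] by (intro fmeasurable.Un) (auto intro: fmeasurableI_null_sets)
      ultimately have "measure lebesgue ({y. y - k \<in> B n} - B n) \<le> measure lebesgue (vH_boundary {k} (A n) \<union> N n)"
        by (intro measure_mono_fmeasurable) auto
      also have "\<dots> = measure lebesgue (vH_boundary {k} (A n))"
        using vH_meas N[of n] by (intro measure_Un_null_set) auto
      finally have "measure lborel ({y. y - k \<in> B n} - B n) \<le> measure lebesgue (vH_boundary {k} (A n))"
        using \<open>{y. y - k \<in> B n} - B n \<in> sets borel\<close> by simp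
      then show ?thesis unfolding measA[symmetric] by (simp add: divide_right_mono)
    qed
    then show "\<forall>\<^sub>F n in sequentially. norm (measure lborel ({y. y - k \<in> B n} - B n) / measure lborel (B n))
        \<le> measure lebesgue (vH_boundary {k} (A n)) / measure lebesgue (A n)" by simp
  qed
  moreover have "emeasure lborel (B n) < \<infinity>" for n
  proof -
    have "emeasure lebesgue (A n) = emeasure lborel (B n)" unfolding B_def using A_meas by simp
    then show ?thesis using A unfolding van_Hove_def by metis
  qed
  moreover have "measure lborel (B n) > 0" for n using A_pos unfolding measA .
  ultimately have "(\<lambda>n. measure lborel (Y \<inter> B n) / measure lborel (B n)) \<longlonglongrightarrow> measure lborel (Y \<inter> F) / measure lborel F"
    by (intro periodic_density[OF F L Y B])
  then show ?thesis unfolding measA meas_int[OF Y(1)] .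
qed

section \<open>Dense preimages of a lattice, and ergodicity\<close>

lemma bij_linear_funpow:
  fixes f :: "real^'n::finite \<Rightarrow> real^'n"
  assumes "linear f" "bij f"
  shows "linear (f ^^ n)" "bij (f ^^ n)" "inv (f ^^ n) = inv f ^^ n"
proof -
  show "linear (f ^^ n)"
    by (induction n) (auto simp: linear_id[unfolded id_def] intro: linear_compose[OF _ assms(1), unfolded o_def] simp: id_def)
  show "bij (f ^^ n)" using assms(2) by (rule bij_betw_funpow)
  show "inv (f ^^ n) = inv f ^^ n" using inv_fn[OF assms(2)] .
qed

text \<open>Rounding \<open>(f ^^ n) w\<close> to a lattice vector leaves an error in the bounded
  set \<open>F\<close>, and the \<open>n\<close>-th iterate of \<open>inv f\<close> makes every such
  error small.\<close>

lemma lattice_refinement_dense: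
  fixes f :: "real^'n::finite \<Rightarrow> real^'n"
  assumes f: "linear f" "bij f" and contr: "\<And>v. (\<lambda>n. (inv f ^^ n) v) \<longlonglongrightarrow> 0"
    and L: "is_lattice L" and e: "e > 0"
  shows "\<exists>n. \<exists>x\<in>L. norm (w - (inv f ^^ n) x) < e"
proof -
  obtain F where F: "fundamental_domain L F" using lattice_fundamental_domain[OF L] by blast
  define g where "g = inv f"
  have lin: "linear (g ^^ n)" for n
    unfolding g_def using bij_linear_funpow(1) linear_bij_homeo(1,2) f by blast
  obtain M where M: "M > 0" "\<And>t. t \<in> F \<Longrightarrow> norm t \<le> M"
    using F unfolding fundamental_domain_def bounded_pos by blast
  \<comment> \<open>Convergence at the finitely many basis vectors already gives uniform smallness
    on \<open>F\<close>.\<close>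
  have "(\<lambda>n. M * (\<Sum>b\<in>Basis. norm ((g ^^ n) b))) \<longlonglongrightarrow> M * (\<Sum>b\<in>(Basis :: (real^'n) set). norm (0 :: real^'n))"
    using contr unfolding g_def by (intro tendsto_intros)
  then have "(\<lambda>n. M * (\<Sum>b\<in>Basis. norm ((g ^^ n) b))) \<longlonglongrightarrow> 0" by simp
  from order_tendstoD(2)[OF this e] obtain n where n: "M * (\<Sum>b\<in>Basis. norm ((g ^^ n) b)) < e"
    by (metis (no_types, lifting) eventually_sequentially order_refl)
  have small: "norm ((g ^^ n) t) < e" if t: "t \<in> F" for t
  proof -
    have "(g ^^ n) t = (\<Sum>b\<in>Basis. (t \<bullet> b) *\<^sub>R (g ^^ n) b)"
      by (subst euclidean_representation[of t, symmetric])
         (simp only: linear_sum[OF lin] linear_cmul[OF lin])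
    then have "norm ((g ^^ n) t) \<le> (\<Sum>b\<in>Basis. norm ((t \<bullet> b) *\<^sub>R (g ^^ n) b))" by (metis norm_sum)
    also have "\<dots> \<le> (\<Sum>b\<in>Basis. M * norm ((g ^^ n) b))"
    proof (rule sum_mono)
      fix b :: "real^'n" assume "b \<in> Basis"
      then have "\<bar>t \<bullet> b\<bar> \<le> M" using Basis_le_norm[of b t] M(2)[OF t] by linarith
      then show "norm ((t \<bullet> b) *\<^sub>R (g ^^ n) b) \<le> M * norm ((g ^^ n) b)" by (simp add: mult_right_mono)
    qed
    finally show ?thesis using n by (simp add: sum_distrib_left)
  qed
  obtain x where x: "x \<in> L" "(f ^^ n) w - x \<in> F" using F unfolding fundamental_domain_def by metis
  have "(g ^^ n) ((f ^^ n) w) = w"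
    using bij_linear_funpow(2,3)[OF f, of n] unfolding g_def by (metis bij_inv_eq_iff)
  then have "(g ^^ n) ((f ^^ n) w - x) = w - (g ^^ n) x" by (simp add: linear_diff[OF lin])
  then show ?thesis using small[OF x(2)] x(1) unfolding g_def by metis
qed

text \<open>This is ergodicity of the expanding torus endomorphism \<open>f\<close>, for open sets: \<open>V\<close> and its preimage
  under \<open>f\<close> have the same density, so \<open>V\<close> is almost invariant under the dense group of all
  \<open>f\<close>-preimages of lattice vectors.\<close>

lemma expanding_ergodic:
  fixes f :: "real^'n::finite \<Rightarrow> real^'n"
  assumes f: "linear f" "bij f" and contr: "\<And>v. (\<lambda>n. (inv f ^^ n) v) \<longlonglongrightarrow> 0"
    and L: "is_lattice L" and inv: "f ` L \<subseteq> L"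
    and V: "open V" "V \<noteq> {}" "periodic_set L V" "\<And>v. v \<in> V \<Longrightarrow> inv f v \<in> V"
  shows "- V \<in> null_sets lborel"
proof -
  obtain F where F: "fundamental_domain L F" using lattice_fundamental_domain[OF L] by blast
  note cL = is_lattice_countable[OF L] and sL = is_lattice_submodule[OF L]
  define g where "g = inv f"
  have gl: "linear g" "bij g" unfolding g_def using linear_bij_homeo(1,2)[OF f] by auto
  have fg: "f (g x) = x" "g (f x) = x" for x
    unfolding g_def using f(2) by (auto simp: bij_is_surj surj_f_inv_f bij_is_inj)
  have fgn: "(f ^^ n) ((g ^^ n) x) = x" "(g ^^ n) ((f ^^ n) x) = x" for n x
    by (induction n arbitrary: x) (simp_all add: fg funpow_swap1)
  have Vb [measurable]: "V \<in> sets borel" using V(1) by simp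
  have Fb [measurable]: "F \<in> sets borel" using F unfolding fundamental_domain_def by simp
  note Fm = fundamental_domain_measure[OF F cL]
  have Lf: "(f ^^ n) x \<in> L" if "x \<in> L" for n x
    using inv that by (induction n) auto
  define W where "W n = (g ^^ n) ` V" for n
  have W_iff: "y \<in> W n \<longleftrightarrow> (f ^^ n) y \<in> V" for y n
  proof
    show "(f ^^ n) y \<in> V" if "y \<in> W n" using that fgn(1) unfolding W_def by auto
    show "y \<in> W n" if "(f ^^ n) y \<in> V"
      unfolding W_def by (rule image_eqI[OF _ that]) (simp add: fgn(2))
  qed
  have Wb [measurable]: "W n \<in> sets borel" for n
    unfolding W_def using linear_bij_homeo(7)[OF bij_linear_funpow(1,2)[OF gl] Vb] .
  have WV: "W n \<subseteq> V" for n
  proof -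
    have "(g ^^ n) v \<in> V" if "v \<in> V" for v using that V(4) unfolding g_def by (induction n) auto
    then show ?thesis unfolding W_def by blast
  qed
  have per: "y + (g ^^ n) x \<in> W n \<longleftrightarrow> y \<in> W n" if "x \<in> L" for x y n
  proof -
    have "(f ^^ n) (y + (g ^^ n) x) = (f ^^ n) y + x"
      using linear_add[OF bij_linear_funpow(1)[OF f]] fgn by metis
    then show ?thesis using V(3) that unfolding W_iff periodic_set_def by simp
  qed
  have perL: "periodic_set L (W n)" for n
    unfolding periodic_set_def
  proof (intro ballI allI)
    fix x y assume "x \<in> L"
    from per[OF Lf[OF this, of n], of y n] show "y + x \<in> W n \<longleftrightarrow> y \<in> W n" by (simp only: fgn)
  qed
  \<comment> \<open>\<open>W n\<close> is periodic under \<open>L\<close> and also under the finer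
    lattice of vectors \<open>(g ^^ n) x\<close>. The density along balls can be computed with
    either lattice. With the finer one it is the density of \<open>V\<close> by linear invariance,
    so the subset \<open>W n\<close> of \<open>V\<close> fills \<open>V\<close> up to a null
    set.\<close>
  have null: "V - W n \<in> null_sets lborel" for n
  proof -
    let ?b = "\<lambda>k. ball (0::real^'n) (real (Suc k))"
    have "fundamental_domain ((g ^^ n) ` L) ((g ^^ n) ` F)"
      by (rule fundamental_domain_linear_image[OF F bij_linear_funpow(1,2)[OF gl]])
    moreover have "countable ((g ^^ n) ` L)" using cL by simp
    moreover have "int_submodule ((g ^^ n) ` L)"
      using int_submodule_linear_image[OF bij_linear_funpow(1)[OF gl] sL] .
    moreover have "periodic_set ((g ^^ n) ` L) (W n)" unfolding periodic_set_def using per by blast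
    ultimately have "(\<lambda>k. measure lborel (W n \<inter> ?b k) / measure lborel (?b k)) \<longlonglongrightarrow>
        measure lborel (W n \<inter> (g ^^ n) ` F) / measure lborel ((g ^^ n) ` F)"
      by (intro periodic_density_ball Wb)
    moreover have "(\<lambda>k. measure lborel (W n \<inter> ?b k) / measure lborel (?b k)) \<longlonglongrightarrow>
        measure lborel (W n \<inter> F) / measure lborel F"
      by (rule periodic_density_ball[OF F cL sL Wb perL])
    ultimately have "measure lborel (W n \<inter> F) / measure lborel F =
        measure lborel (W n \<inter> (g ^^ n) ` F) / measure lborel ((g ^^ n) ` F)"
      using LIMSEQ_unique by blast
    also have "\<dots> = measure lborel (V \<inter> F) / measure lborel F"
      unfolding W_def by (rule measure_ratio_linear_image[OF bij_linear_funpow(1,2)[OF gl] Vb Fb])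
    finally have eq: "measure lborel (W n \<inter> F) = measure lborel (V \<inter> F)" using Fm(2) by simp
    have fin: "emeasure lborel (S \<inter> F) \<noteq> \<top>" if "S \<in> sets borel" for S
    proof -
      have "emeasure lborel (S \<inter> F) \<le> emeasure lborel F" by (intro emeasure_mono) auto
      then show ?thesis using Fm(1) by (auto simp: top_unique)
    qed
    have "emeasure lborel ((V - W n) \<inter> F) = emeasure lborel ((V \<inter> F) - (W n \<inter> F))"
      by (rule arg_cong[where f = "emeasure lborel"]) auto
    also have "\<dots> = emeasure lborel (V \<inter> F) - emeasure lborel (W n \<inter> F)"
      using WV[of n] fin[OF Wb, of n] by (intro emeasure_Diff) auto
    also have "\<dots> = 0"
      using eq fin[OF Wb, of n] fin[OF Vb] by (simp add: emeasure_eq_ennreal_measure)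
    finally have "emeasure lborel ((V - W n) \<inter> F) = 0" .
    then show ?thesis
      using perL[of n] V(3) by (intro periodic_null[OF F cL]) (auto simp: periodic_set_def)
  qed
  obtain u e where u: "e > 0" "ball u e \<subseteq> V" using V(1,2) open_contains_ball by (metis ex_in_conv)
  define S where "S n x = {y. y + (- ((g ^^ n) x)) \<in> V - W n}" for n x
  have "S n x \<in> null_sets lborel" for n x
  proof (rule null_setsI)
    have "V - W n \<in> sets borel" by measurable
    then show "emeasure lborel (S n x) = 0"
      unfolding S_def using emeasure_lborel_shift[of "V - W n"] null[of n] by (simp only: null_setsD1)
    have "S n x = {y. y + (- ((g ^^ n) x)) \<in> V} - {y. y + (- ((g ^^ n) x)) \<in> W n}" unfolding S_def by auto
    also have "\<dots> \<in> sets lborel" by measurable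
    finally show "S n x \<in> sets lborel" .
  qed
  then have "(\<Union>n. \<Union>x\<in>L. S n x) \<in> null_sets lborel"
    using cL by (intro null_sets_UN' null_sets_UN) auto
  \<comment> \<open>A point \<open>z\<close> outside \<open>V\<close> can be moved into the ball
    inside \<open>V\<close> by subtracting some \<open>(g ^^ n) x\<close>. It cannot land in
    \<open>W n\<close>, because \<open>W n\<close> has this period and lies in \<open>V\<close>. So
    \<open>z\<close> belongs to one of countably many translates of null sets.\<close>
  moreover have "- V \<subseteq> (\<Union>n. \<Union>x\<in>L. S n x)"
  proof
    fix z assume z: "z \<in> - V"
    obtain n x where nx: "x \<in> L" "norm ((z - u) - (g ^^ n) x) < e"
      using lattice_refinement_dense[OF f contr L u(1)] unfolding g_def by metis
    then have "z - (g ^^ n) x \<in> ball u e" by (simp add: dist_norm norm_minus_commute algebra_simps)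
    then have "z - (g ^^ n) x \<in> V" using u(2) by blast
    moreover have "z - (g ^^ n) x \<notin> W n"
    proof
      assume "z - (g ^^ n) x \<in> W n"
      then have "z \<in> W n" using per[OF nx(1), of "z - (g ^^ n) x" n] by simp
      then show False using WV z by blast
    qed
    ultimately show "z \<in> (\<Union>n. \<Union>x\<in>L. S n x)" using nx(1) unfolding S_def by auto
  qed
  moreover have "- V \<in> sets lborel" using V(1) by simp
  ultimately show ?thesis using null_sets_subset by blast
qed

subsection \<open>Periodic tiles in substitution tilings\<close>

lemma tile_translate_simps [simp]:
  "T +\<^sub>t 0 = T" "T +\<^sub>t x +\<^sub>t y = T +\<^sub>t (x + y)" "fst (T +\<^sub>t x) = (\<lambda>y. y + x) ` fst T"
  for x y :: "real^'n::finite"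
  by (auto simp: tile_translate_def image_image add.assoc)

text \<open>The functional \<open>v \<bullet> (x - y)\<close> attains a maximum on the compact
  support, but a nonzero period \<open>x - y\<close> would increase it.\<close>

lemma tile_translate_inj:
  fixes x y :: "real^'n::finite"
  assumes eq: "T +\<^sub>t x = T +\<^sub>t y" and T: "compact (fst T)" "fst T \<noteq> {}"
  shows "x = y"
proof -
  have "continuous_on (fst T) (\<lambda>v. v \<bullet> (x - y))" by (intro continuous_intros)
  then obtain m where m: "m \<in> fst T" "\<And>v. v \<in> fst T \<Longrightarrow> v \<bullet> (x - y) \<le> m \<bullet> (x - y)"
    using continuous_attains_sup[OF T] by metis
  have "m + x \<in> (\<lambda>v. v + y) ` fst T" using eq m(1) by (auto simp: tile_translate_def)
  then have "m + (x - y) \<in> fst T" by (auto simp: algebra_simps)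
  then have "(m + (x - y)) \<bullet> (x - y) \<le> m \<bullet> (x - y)" by (rule m(2))
  then have "(x - y) \<bullet> (x - y) \<le> 0" by (simp add: inner_left_distrib)
  then show ?thesis by (metis eq_iff_diff_eq_0 inner_eq_zero_iff inner_ge_zero order_antisym)
qed

lemma interior_translate: "interior ((\<lambda>y. y + x) ` S) = (\<lambda>y. y + x) ` interior S"
  for x :: "real^'n::finite"
  using interior_translation[of x S] by (simp add: add.commute)

lemma separated_bounded_finite:
  fixes X :: "'a::euclidean_space set"
  assumes "bounded X" "r > 0" "\<And>x y. x \<in> X \<Longrightarrow> y \<in> X \<Longrightarrow> x \<noteq> y \<Longrightarrow> r \<le> dist x y"
  shows "finite X"
proof (rule ccontr)
  assume "infinite X"
  then obtain l where l: "l islimpt X" using bounded_infinite_imp_islimpt[OF order_refl assms(1)] by blast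
  then obtain x where x: "x \<in> X" "x \<noteq> l" "dist x l < r / 2"
    using assms(2) unfolding islimpt_approachable by (metis half_gt_zero)
  then obtain y where y: "y \<in> X" "y \<noteq> l" "dist y l < dist x l"
    using l unfolding islimpt_approachable by (metis zero_less_dist_iff)
  have "x \<noteq> y" using y(3) by auto
  then have "r \<le> dist x y" using assms(3) x(1) y(1) by blast
  also have "\<dots> \<le> dist x l + dist y l" by (metis dist_commute dist_triangle)
  finally show False using x(3) y(3) by linarith
qed

section \<open>Tiles of a self-affine tiling\<close>

locale substitution_tiling =
  fixes A :: "('n::finite, 'l) tile set" and Q :: "real^'n^'n"
    and \<omega> :: "('n, 'l) tile \<Rightarrow> ('n, 'l) tile set" and \<T> :: "('n, 'l) tile set"
  assumes rule: "subst_rule A Q \<omega>" and prim: "primitive A \<omega>" and saf: "self_affine_tiling A Q \<omega> \<T>"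
begin

abbreviation q :: "real^'n \<Rightarrow> real^'n" where "q \<equiv> \<lambda>v. Q *v v"

lemma q_linear: "linear q" by (rule matrix_vector_mul_linear)

lemma q_bij: "bij q"
  by (rule expanding_inverse_tendsto_zero(1)) (use rule in \<open>simp add: subst_rule_def\<close>)

lemma q_contracting: "(\<lambda>n. (inv q ^^ n) v) \<longlonglongrightarrow> 0"
  by (rule expanding_inverse_tendsto_zero(2)) (use rule in \<open>simp add: subst_rule_def\<close>)

lemma qn_linear: "linear (q ^^ n)" and qn_bij: "bij (q ^^ n)" and qn_inv: "inv (q ^^ n) = inv q ^^ n"
  using bij_linear_funpow[OF q_linear q_bij] by auto

lemma finite_prototiles: "finite A"
  using rule unfolding subst_rule_def by blast

lemma prototile: "P \<in> A \<Longrightarrow> is_tile P"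
  using rule unfolding subst_rule_def by blast

text \<open>\<open>is_tile\<close> admits the empty support. Such a tile equals all its translates,
  so the set counted by \<open>subst_matrix\<close> is empty or the whole space. Since
  \<open>card\<close> of an infinite set is \<open>0\<close>, its row vanishes in both cases,
  against primitivity.\<close>

lemma prototile_nonempty:
  assumes "P \<in> A" shows "fst P \<noteq> {}"
proof
  assume e: "fst P = {}"
  have "P +\<^sub>t x = P" for x using e by (simp add: tile_translate_def prod_eq_iff)
  then have "{x. P +\<^sub>t x \<in> \<omega> P'} = {} \<or> {x. P +\<^sub>t x \<in> \<omega> P'} = UNIV" for P' by auto
  moreover have "infinite (UNIV :: (real^'n) set)"
    using not_bounded_UNIV finite_imp_bounded by blast
  ultimately have "subst_matrix A \<omega> P P' = 0" for P' unfolding subst_matrix_def by (metis card.empty card.infinite)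
  then have "mat_pow_on A (subst_matrix A \<omega>) (Suc k) P P = 0" for k by simp
  moreover obtain k where "k > 0" "mat_pow_on A (subst_matrix A \<omega>) k P P > 0"
    using prim assms unfolding primitive_def by blast
  ultimately show False by (metis gr0_implies_Suc less_irrefl)
qed

lemma tile_of_prototile:
  assumes "T \<in> \<T>" obtains P x where "P \<in> A" "T = P +\<^sub>t x"
  using saf assms unfolding self_affine_tiling_def by blast

lemma tile:
  assumes "T \<in> \<T>"
  shows "compact (fst T)" "closure (interior (fst T)) = fst T" "fst T \<noteq> {}" "interior (fst T) \<noteq> {}"
proof -
  have "is_tile T" using saf assms unfolding self_affine_tiling_def is_tiling_def is_patch_def by blast
  then show "compact (fst T)" and c: "closure (interior (fst T)) = fst T" unfolding is_tile_def by auto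
  show n: "fst T \<noteq> {}" using tile_of_prototile[OF assms] prototile_nonempty
    by (metis empty_is_image tile_translate_simps(3))
  show "interior (fst T) \<noteq> {}" using c n by auto
qed

text \<open>Tiles are closures of their interiors, so an open set that meets \<open>T\<close> meets
  the interior of \<open>T\<close>. This is how boundary points are handled throughout.\<close>

lemma tile_eqI:
  assumes "S \<in> \<T>" "T \<in> \<T>" "interior (fst S) \<inter> fst T \<noteq> {}"
  shows "S = T"
proof -
  obtain z where z: "z \<in> interior (fst S)" "z \<in> closure (interior (fst T))"
    using assms tile(2) by blast
  then have "interior (fst S) \<inter> interior (fst T) \<noteq> {}"
    using open_Int_closure_eq_empty[of "interior (fst S)" "interior (fst T)"] by auto
  then show ?thesis using saf assms unfolding self_affine_tiling_def is_tiling_def is_patch_def by blast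
qed

lemma tiling_dense:
  assumes "open U" "U \<noteq> {}" obtains T where "T \<in> \<T>" "fst T \<inter> U \<noteq> {}"
proof -
  have "closure (\<Union>T\<in>\<T>. fst T) = UNIV"
    using saf unfolding self_affine_tiling_def is_tiling_def supp_def by blast
  then have "U \<inter> closure (\<Union>T\<in>\<T>. fst T) \<noteq> {}" using assms by auto
  then have "U \<inter> (\<Union>T\<in>\<T>. fst T) \<noteq> {}" using open_Int_closure_eq_empty[OF assms(1)] by blast
  then show ?thesis using that by blast
qed

section \<open>Tiles with a group of periods\<close>

definition periodic_under :: "(real^'n) set \<Rightarrow> ('n, 'l) tile \<Rightarrow> bool" where
  "periodic_under \<Lambda> T \<longleftrightarrow> T \<in> \<T> \<and> (\<forall>x\<in>\<Lambda>. T +\<^sub>t x \<in> \<T>)"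

lemma periodic_under_mono: "periodic_under \<Lambda> T \<Longrightarrow> \<Lambda>' \<subseteq> \<Lambda> \<Longrightarrow> periodic_under \<Lambda>' T"
  unfolding periodic_under_def by blast

lemma periodic_under_translate:
  assumes "periodic_under \<Lambda> T" "int_submodule \<Lambda>" "x \<in> \<Lambda>" shows "periodic_under \<Lambda> (T +\<^sub>t x)"
  using assms int_submodule_closed(1) unfolding periodic_under_def by auto

text \<open>Substituting all translates of \<open>T\<close> by \<open>\<Lambda>\<close> gives
  translates of one patch by the image of \<open>\<Lambda>\<close>, all inside the fixed tiling; any
  tile of that patch covering \<open>q z\<close> will do.\<close>

lemma periodic_under_step:
  assumes "periodic_under \<Lambda> T" "z \<in> fst T"
  obtains T' where "periodic_under (q ` \<Lambda>) T'" "q z \<in> fst T'"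
proof -
  have T: "T \<in> \<T>" using assms(1) unfolding periodic_under_def by blast
  then obtain P y where P: "P \<in> A" "T = P +\<^sub>t y" using tile_of_prototile by blast
  have sub: "\<omega> P +\<^sub>p q x \<subseteq> \<T>" if "P +\<^sub>t x \<in> \<T>" for x
  proof -
    have "\<omega> P +\<^sub>p q x \<subseteq> omega_ext A Q \<omega> \<T>" unfolding omega_ext_def using P(1) that by blast
    then show ?thesis using saf unfolding self_affine_tiling_def by simp
  qed
  have w: "finite (\<omega> P)" "is_patch (\<omega> P)" "supp (\<omega> P) = q ` fst P"
    using rule P(1) unfolding subst_rule_def by auto
  \<comment> \<open>The closure in \<open>supp\<close> is harmless for a finite patch, so
    \<open>q z\<close> lies in an actual tile.\<close>
  have "closed (\<Union>S\<in>\<omega> P. fst S)"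
    using w(1,2) unfolding is_patch_def is_tile_def by (intro closed_UN) (auto intro: compact_imp_closed)
  then have "(\<Union>S\<in>\<omega> P. fst S) = q ` fst P" using w(3) unfolding supp_def by simp
  moreover have "z - y \<in> fst P" using assms(2) unfolding P(2) by auto
  ultimately obtain S where S: "S \<in> \<omega> P" "q (z - y) \<in> fst S" by blast
  have "periodic_under (q ` \<Lambda>) (S +\<^sub>t q y)"
    unfolding periodic_under_def
  proof (intro conjI ballI)
    show "S +\<^sub>t q y \<in> \<T>" using sub[of y] T S(1) unfolding P(2) patch_translate_def by blast
    fix x' assume "x' \<in> q ` \<Lambda>"
    then obtain x where x: "x \<in> \<Lambda>" "x' = q x" by blast
    have "P +\<^sub>t (y + x) \<in> \<T>" using assms(1) x(1) unfolding periodic_under_def P(2) by auto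
    then have "S +\<^sub>t q (y + x) \<in> \<T>" using sub[of "y + x"] S(1) unfolding patch_translate_def by blast
    then show "S +\<^sub>t q y +\<^sub>t x' \<in> \<T>" by (simp add: x(2) matrix_vector_right_distrib)
  qed
  moreover have "q z \<in> fst (S +\<^sub>t q y)"
    using S(2) by (auto simp: matrix_vector_mult_diff_distrib image_iff intro!: bexI[of _ "q (z - y)"])
  ultimately show ?thesis using that by blast
qed

lemma periodic_under_steps:
  assumes "periodic_under \<Lambda> T" "z \<in> fst T"
  shows "\<exists>T'. periodic_under ((q ^^ n) ` \<Lambda>) T' \<and> (q ^^ n) z \<in> fst T'"
proof (induction n)
  case 0 then show ?case using assms by (intro exI[of _ T]) simp
next
  case (Suc n)
  then obtain T' where "periodic_under ((q ^^ n) ` \<Lambda>) T'" "(q ^^ n) z \<in> fst T'" by blast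
  then obtain T'' where "periodic_under (q ` (q ^^ n) ` \<Lambda>) T''" "q ((q ^^ n) z) \<in> fst T''" using periodic_under_step by blast
  then show ?case by (intro exI[of _ T'']) (simp add: image_comp o_def)
qed

text \<open>\<open>r\<close> is the radius of a ball inside \<open>T\<close>. Translates by vectors
  closer than \<open>r\<close> overlap in an interior point, hence are the same tile.\<close>

lemma periodic_under_separated:
  assumes "periodic_under \<Lambda> T" "periodic_under \<Lambda>' T"
  obtains r where "r > 0" "\<And>x y. x \<in> \<Lambda> \<Longrightarrow> y \<in> \<Lambda>' \<Longrightarrow> x \<noteq> y \<Longrightarrow> r \<le> dist x y"
proof -
  have T: "T \<in> \<T>" using assms unfolding periodic_under_def by blast
  obtain c r where r: "r > 0" "ball c r \<subseteq> interior (fst T)"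
    using tile(4)[OF T] open_contains_ball[of "interior (fst T)"] by (metis ex_in_conv open_interior)
  have "r \<le> dist x y" if xy: "x \<in> \<Lambda>" "y \<in> \<Lambda>'" "x \<noteq> y" for x y
  proof (rule ccontr)
    assume "\<not> r \<le> dist x y"
    then have "c + (y - x) \<in> ball c r" by (simp add: dist_norm norm_minus_commute)
    then have "c + y \<in> (\<lambda>v. v + x) ` interior (fst T)" using r(2) by (auto simp: image_iff algebra_simps intro!: bexI[of _ "c + (y - x)"])
    moreover have "c + y \<in> (\<lambda>v. v + y) ` fst T" using r interior_subset by fastforce
    ultimately have "interior (fst (T +\<^sub>t x)) \<inter> fst (T +\<^sub>t y) \<noteq> {}" by (auto simp: interior_translate)
    then have "T +\<^sub>t x = T +\<^sub>t y" using assms xy unfolding periodic_under_def by (intro tile_eqI) auto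
    then show False using tile_translate_inj tile(1,3)[OF T] xy(3) by blast
  qed
  then show ?thesis using that r(1) by blast
qed

text \<open>The sets \<open>(q ^^ n) ` (interior T + \<Lambda>)\<close> all have the same positive density, so two of them
  overlap. A tile in the overlap is periodic under two different images of \<open>\<Lambda>\<close>, whose sum is then
  uniformly discrete.\<close>

lemma overlapping_periods:
  assumes L: "is_lattice \<Lambda>" and T: "periodic_under \<Lambda> T"
  obtains m n T' where "n < m" "periodic_under ((q ^^ n) ` \<Lambda>) T'" "periodic_under ((q ^^ m) ` \<Lambda>) T'"
proof -
  obtain F where F: "fundamental_domain \<Lambda> F" using lattice_fundamental_domain[OF L] by blast
  note cL = is_lattice_countable[OF L] and sL = is_lattice_submodule[OF L]
  have Fb [measurable]: "F \<in> sets borel" using F unfolding fundamental_domain_def by simp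
  have TT: "T \<in> \<T>" using T unfolding periodic_under_def by blast
  define D where "D = (\<Union>x\<in>\<Lambda>. (\<lambda>y. y + x) ` interior (fst T))"
  have Dopen: "open D"
    unfolding D_def by (intro open_UN ballI) (simp flip: interior_translate)
  then have Db [measurable]: "D \<in> sets borel" by simp
  have D_shift: "y + x \<in> D" if "y \<in> D" "x \<in> \<Lambda>" for x y
  proof -
    obtain z w where "z \<in> \<Lambda>" "w \<in> interior (fst T)" "y = w + z" using \<open>y \<in> D\<close> unfolding D_def by blast
    then show ?thesis unfolding D_def using int_submodule_closed(1)[OF sL _ \<open>x \<in> \<Lambda>\<close>, of z]
      by (intro UN_I[of "z + x"]) (auto simp: add.assoc)
  qed
  have Dper: "periodic_set \<Lambda> D"
    unfolding periodic_set_def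
  proof (intro ballI allI iffI)
    fix x y assume x: "x \<in> \<Lambda>" and "y + x \<in> D"
    then have "y + x + (- x) \<in> D" using D_shift int_submodule_closed(3)[OF sL x x] by blast
    then show "y \<in> D" by simp
  qed (use D_shift in blast)
  have "0 \<in> \<Lambda>" using sL zmod.subspace_0 by blast
  then have Dne: "D \<noteq> {}" unfolding D_def using tile(4)[OF TT] by auto
  define c where "c = measure lborel (D \<inter> F) / measure lborel F"
  note Fm = fundamental_domain_measure[OF F cL]
  have c: "c > 0"
  proof -
    have "emeasure lborel (D \<inter> F) \<noteq> 0"
      using periodic_null[OF F cL Db Dper] open_not_negligible[OF Dopen Dne] negligible_iff_null_sets
        null_sets_completionI by blast
    moreover have "emeasure lborel (D \<inter> F) \<le> emeasure lborel F" by (intro emeasure_mono) auto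
    ultimately have "measure lborel (D \<inter> F) > 0" using Fm(1)
      by (auto simp: measure_def enn2real_positive_iff zero_less_iff_neq_zero intro: le_less_trans)
    then show ?thesis unfolding c_def using Fm(2) by simp
  qed
  let ?b = "\<lambda>k. ball (0::real^'n) (real (Suc k))"
  define E where "E n = (q ^^ n) ` D" for n
  have Eb [measurable]: "E n \<in> sets borel" for n
    unfolding E_def using linear_bij_homeo(7)[OF qn_linear qn_bij Db] .
  have dens: "(\<lambda>k. measure lborel (E n \<inter> ?b k) / measure lborel (?b k)) \<longlonglongrightarrow> c" for n
  proof -
    have "periodic_set ((q ^^ n) ` \<Lambda>) (E n)"
      unfolding periodic_set_def
    proof (intro ballI allI)
      fix x y assume "x \<in> (q ^^ n) ` \<Lambda>"
      then obtain x' where x': "x' \<in> \<Lambda>" "x = (q ^^ n) x'" by blast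
      obtain y' where y': "y = (q ^^ n) y'" using bij_is_surj[OF qn_bij] by (metis surjE)
      have "y + x = (q ^^ n) (y' + x')" unfolding x' y' using linear_add[OF qn_linear] by simp
      then have "y + x \<in> E n \<longleftrightarrow> y' + x' \<in> D"
        unfolding E_def using inj_image_mem_iff[OF bij_is_inj[OF qn_bij]] by simp
      also have "\<dots> \<longleftrightarrow> y' \<in> D" using Dper x'(1) unfolding periodic_set_def by blast
      also have "\<dots> \<longleftrightarrow> y \<in> E n" unfolding E_def y' using inj_image_mem_iff[OF bij_is_inj[OF qn_bij]] by simp
      finally show "y + x \<in> E n \<longleftrightarrow> y \<in> E n" .
    qed
    then have "(\<lambda>k. measure lborel (E n \<inter> ?b k) / measure lborel (?b k)) \<longlonglongrightarrow>
        measure lborel (E n \<inter> (q ^^ n) ` F) / measure lborel ((q ^^ n) ` F)"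
      using cL int_submodule_linear_image[OF qn_linear sL]
      by (intro periodic_density_ball[OF fundamental_domain_linear_image[OF F qn_linear qn_bij]]) auto
    then show ?thesis unfolding E_def c_def measure_ratio_linear_image[OF qn_linear qn_bij Db Fb] .
  qed
  have "\<exists>n m. n < m \<and> E n \<inter> E m \<noteq> {}"
  proof (rule ccontr)
    assume "\<not> ?thesis"
    then have disj: "disjoint_family_on E {..<N}" for N
      unfolding disjoint_family_on_def by (metis Int_commute nat_neq_iff)
    \<comment> \<open>Pigeonhole: \<open>N\<close> disjoint sets of density \<open>c\<close> would
      have total density above \<open>1\<close>.\<close>
    obtain N where N: "real N * c > 1" using ex_less_of_nat_mult[OF c] by blast
    have "(\<Sum>n<N. measure lborel (E n \<inter> ?b k) / measure lborel (?b k)) \<le> 1" for k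
    proof -
      have fin: "emeasure lborel (?b k) < \<infinity>" by (rule emeasure_bounded_finite) simp
      have fm: "?b k \<in> fmeasurable lborel" using fin by (intro fmeasurableI) auto
      have "(\<Sum>n<N. measure lborel (E n \<inter> ?b k)) = measure lborel (\<Union>n<N. E n \<inter> ?b k)"
      proof (rule measure_finite_Union[symmetric])
        show "disjoint_family_on (\<lambda>n. E n \<inter> ?b k) {..<N}"
          using disj[of N] unfolding disjoint_family_on_def by blast
        show "emeasure lborel (E n \<inter> ?b k) \<noteq> \<infinity>" for n
        proof -
          have "emeasure lborel (E n \<inter> ?b k) \<le> emeasure lborel (?b k)" by (intro emeasure_mono) auto
          then show ?thesis using fin by (auto simp: top_unique)
        qed
      qed auto
      also have "\<dots> \<le> measure lborel (?b k)" by (rule measure_mono_fmeasurable[OF _ _ fm]) auto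
      finally have "(\<Sum>n<N. measure lborel (E n \<inter> ?b k)) / measure lborel (?b k) \<le> 1"
        by (simp add: divide_le_eq_1)
      then show ?thesis by (simp add: sum_divide_distrib)
    qed
    moreover have "(\<lambda>k. \<Sum>n<N. measure lborel (E n \<inter> ?b k) / measure lborel (?b k)) \<longlonglongrightarrow> (\<Sum>n<N. c)"
      by (intro tendsto_sum dens)
    ultimately have "(\<Sum>n<N. c) \<le> 1" by (intro LIMSEQ_le_const2) auto
    then show False using N by simp
  qed
  then obtain n m z where nm: "n < m" "z \<in> E n" "z \<in> E m" by blast
  have cover: "\<exists>T'. periodic_under ((q ^^ n) ` \<Lambda>) T' \<and> z \<in> fst T'" if z: "z \<in> E n" for n z
  proof -
    obtain x u where x: "x \<in> \<Lambda>" "u \<in> interior (fst T)" "z = (q ^^ n) (u + x)"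
      using z unfolding E_def D_def by blast
    have "u + x \<in> fst (T +\<^sub>t x)" using x(2) interior_subset by auto
    then show ?thesis using periodic_under_steps[OF periodic_under_translate[OF T sL x(1)]] x(3) by blast
  qed
  obtain T1 where T1: "periodic_under ((q ^^ n) ` \<Lambda>) T1" "z \<in> fst T1" using cover nm(2) by blast
  have T1': "T1 \<in> \<T>" using T1 unfolding periodic_under_def by blast
  \<comment> \<open>\<open>z\<close> may be a boundary point of \<open>T1\<close>. Since
    \<open>E m\<close> is open, \<open>z\<close> can be replaced by a point \<open>z'\<close> of
    \<open>E m\<close> in the interior of \<open>T1\<close>, which forces the two tiles to
    coincide.\<close>
  have "open (E m)"
  proof -
    have "E m = inv (q ^^ m) -` D"
      unfolding E_def using bij_vimage_eq_inv_image[of "inv (q ^^ m)"] qn_bij by (simp add: bij_imp_bij_inv inv_inv_eq)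
    then show ?thesis using linear_bij_homeo(4)[OF qn_linear qn_bij] Dopen by (simp add: open_vimage)
  qed
  moreover have "z \<in> closure (interior (fst T1))" using T1(2) tile(2)[OF T1'] by simp
  ultimately obtain z' where z': "z' \<in> E m" "z' \<in> interior (fst T1)"
    using nm(3) open_Int_closure_eq_empty[of "E m" "interior (fst T1)"] by blast
  obtain T2 where T2: "periodic_under ((q ^^ m) ` \<Lambda>) T2" "z' \<in> fst T2" using cover z'(1) by blast
  have "T1 = T2" using z'(2) T2 T1' unfolding periodic_under_def by (intro tile_eqI) auto
  then show ?thesis using that nm(1) T1(1) T2(1) by blast
qed

text \<open>For \<open>y = (q ^^ m) x\<close>, reduce the multiples of \<open>y\<close> modulo the
  image of \<open>\<Lambda>\<close> under \<open>q ^^ n\<close>. The remainders are bounded and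
  separated, hence finite in number, so two multiples agree and a positive multiple of
  \<open>y\<close> lies in that image. Cancelling \<open>q ^^ n\<close> leaves the exponent
  \<open>m - n\<close>.\<close>

lemma commensurable_power:
  assumes L: "is_lattice \<Lambda>" and T: "periodic_under \<Lambda> T"
  obtains p where "p > 0" "\<And>x. x \<in> \<Lambda> \<Longrightarrow> \<exists>N::nat. N > 0 \<and> real N *\<^sub>R (q ^^ p) x \<in> \<Lambda>"
proof -
  obtain m n T' where T': "n < m" "periodic_under ((q ^^ n) ` \<Lambda>) T'" "periodic_under ((q ^^ m) ` \<Lambda>) T'"
    by (rule overlapping_periods[OF L T])
  obtain r where r: "r > 0"
    "\<And>x y. x \<in> (q ^^ n) ` \<Lambda> \<Longrightarrow> y \<in> (q ^^ m) ` \<Lambda> \<Longrightarrow> x \<noteq> y \<Longrightarrow> r \<le> dist x y"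
    using periodic_under_separated[OF T'(2,3)] by blast
  obtain F where F: "fundamental_domain \<Lambda> F" using lattice_fundamental_domain[OF L] by blast
  note sL = is_lattice_submodule[OF L]
  have sub: "int_submodule ((q ^^ k) ` \<Lambda>)" for k using int_submodule_linear_image[OF qn_linear sL] .
  have Fn: "fundamental_domain ((q ^^ n) ` \<Lambda>) ((q ^^ n) ` F)"
    by (rule fundamental_domain_linear_image[OF F qn_linear qn_bij])
  have "\<exists>N::nat. N > 0 \<and> real N *\<^sub>R (q ^^ (m - n)) x \<in> \<Lambda>" if x: "x \<in> \<Lambda>" for x
  proof -
    define y where "y = (q ^^ m) x"
    have y: "y \<in> (q ^^ m) ` \<Lambda>" unfolding y_def using x by blast
    have "\<forall>j::nat. \<exists>l. l \<in> (q ^^ n) ` \<Lambda> \<and> real j *\<^sub>R y - l \<in> (q ^^ n) ` F"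
      using Fn unfolding fundamental_domain_def by (intro allI ex1_implies_ex) blast
    then obtain l where l: "\<And>j::nat. l j \<in> (q ^^ n) ` \<Lambda>" "\<And>j. real j *\<^sub>R y - l j \<in> (q ^^ n) ` F"
      unfolding choice_iff by blast
    define w where "w j = real j *\<^sub>R y - l j" for j
    have diff: "of_int (int i - int j) *\<^sub>R y \<in> (q ^^ m) ` \<Lambda>" "l i - l j \<in> (q ^^ n) ` \<Lambda>"
      "w i - w j = of_int (int i - int j) *\<^sub>R y - (l i - l j)" for i j
      by (rule int_submodule_closed(4)[OF sub y y], rule int_submodule_closed(2)[OF sub l(1) l(1)])
         (simp add: w_def algebra_simps)
    \<comment> \<open>The difference of two remainders is a multiple of \<open>y\<close> minus a
      vector of the other lattice, exactly the kind of distance that \<open>r\<close> bounds from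
      below.\<close>
    have sep: "r \<le> dist (w i) (w j)" if "w i \<noteq> w j" for i j
    proof -
      have "l i - l j \<noteq> of_int (int i - int j) *\<^sub>R y" using that diff(3)[of i j] by auto
      then show ?thesis
        using r(2)[OF diff(2)[of i j] diff(1)[of i j]] norm_minus_commute[of "l i - l j"]
        unfolding dist_norm diff(3)[of i j] by metis
    qed
    have "range w \<subseteq> (q ^^ n) ` F" unfolding w_def using l(2) by blast
    then have "bounded (range w)" using Fn bounded_subset unfolding fundamental_domain_def by blast
    then have "finite (range w)" using separated_bounded_finite[OF _ r(1)] sep by blast
    then have "\<not> inj w" using finite_imageD infinite_UNIV_nat by blast
    then obtain i j where "w i = w j" "i \<noteq> j" unfolding inj_def by blast
    then obtain i j where ij: "w i = w j" "j < i" by (metis nat_neq_iff)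
    have "of_int (int i - int j) *\<^sub>R y = l i - l j" using diff(3)[of i j] unfolding ij(1) by (metis diff_self eq_iff_diff_eq_0)
    moreover have "real_of_int (int i - int j) = real (i - j)"
      unfolding of_int_diff of_int_of_nat_eq of_nat_diff[OF less_imp_le[OF ij(2)]] ..
    ultimately have "real (i - j) *\<^sub>R y \<in> (q ^^ n) ` \<Lambda>" using diff(2)[of i j] by metis
    moreover have "y = (q ^^ n) ((q ^^ (m - n)) x)"
      using T'(1) funpow_add[of n "m - n" q] unfolding y_def by simp
    ultimately have "(q ^^ n) (real (i - j) *\<^sub>R (q ^^ (m - n)) x) \<in> (q ^^ n) ` \<Lambda>"
      by (simp only: linear_cmul[OF qn_linear])
    then have "real (i - j) *\<^sub>R (q ^^ (m - n)) x \<in> \<Lambda>"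
      using inj_image_mem_iff[OF bij_is_inj[OF qn_bij]] by blast
    then show ?thesis using ij(2) by (intro exI[of _ "i - j"]) simp
  qed
  then show ?thesis using that[of "m - n"] T'(1) by simp
qed

subsection \<open>An invariant lattice of periods\<close>

text \<open>\<open>tiling_FLC\<close> bounds the number of patches up to translation, not their
  sizes. Finiteness comes from the finite prototile set: it gives one inner radius \<open>r0\<close>
  and one outer radius \<open>M0\<close> for all tiles, so the centres of the tiles meeting a ball
  are separated and bounded.\<close>

lemma finite_patch_meet: "finite (\<T> \<sqinter>\<^sub>p cball z \<rho>)"
proof -
  have "\<forall>P\<in>A. \<exists>c r. r > 0 \<and> ball c r \<subseteq> interior (fst P)"
  proof
    fix P assume P: "P \<in> A"
    then have "interior (fst P) \<noteq> {}"
      using prototile[OF P] prototile_nonempty[OF P] unfolding is_tile_def by auto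
    then show "\<exists>c r. r > 0 \<and> ball c r \<subseteq> interior (fst P)"
      using open_contains_ball[of "interior (fst P)"] by (metis ex_in_conv open_interior)
  qed
  then obtain c r where r: "\<And>P. P \<in> A \<Longrightarrow> r P > 0" "\<And>P. P \<in> A \<Longrightarrow> ball (c P) (r P) \<subseteq> interior (fst P)"
    by metis
  have bnd: "\<forall>P\<in>A. \<exists>M. \<forall>u\<in>fst P. dist (c P) u \<le> M"
    using prototile unfolding is_tile_def by (metis bounded_any_center compact_imp_bounded)
  then obtain M where M: "\<And>P u. P \<in> A \<Longrightarrow> u \<in> fst P \<Longrightarrow> dist (c P) u \<le> M P" by metis
  have Mub: "\<exists>M0. \<forall>P\<in>A. M P \<le> M0" "\<exists>r0>0. \<forall>P\<in>A. r0 \<le> r P"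
  proof -
    show "\<exists>M0. \<forall>P\<in>A. M P \<le> M0"
      using finite_prototiles by (intro exI[of _ "Max (M ` A)"]) auto
    show "\<exists>r0>0. \<forall>P\<in>A. r0 \<le> r P"
    proof (intro exI conjI ballI)
      \<comment> \<open>Inserting \<open>1\<close> keeps the minimum meaningful for an empty
        prototile set.\<close>
      show "Min (insert 1 (r ` A)) > 0" using finite_prototiles r(1) by (subst Min_gr_iff) auto
      show "Min (insert 1 (r ` A)) \<le> r P" if "P \<in> A" for P using finite_prototiles that by (intro Min_le) auto
    qed
  qed
  obtain M0 where M0: "\<And>P. P \<in> A \<Longrightarrow> M P \<le> M0" using Mub(1) by blast
  obtain r0 where r0: "r0 > 0" "\<And>P. P \<in> A \<Longrightarrow> r0 \<le> r P" using Mub(2) by blast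
  have "\<forall>T\<in>\<T>. \<exists>e. ball e r0 \<subseteq> interior (fst T) \<and> (\<forall>u\<in>fst T. dist e u \<le> M0)"
  proof
    fix T assume "T \<in> \<T>"
    then obtain P x where P: "P \<in> A" "T = P +\<^sub>t x" using tile_of_prototile by blast
    have s: "ball (c P) r0 \<subseteq> interior (fst P)" using r(2)[OF P(1)] r0(2)[OF P(1)] subset_ball by blast
    have "ball (c P + x) r0 \<subseteq> interior (fst T)"
      unfolding P(2) tile_translate_simps interior_translate
    proof
      fix y assume "y \<in> ball (c P + x) r0"
      then have "y - x \<in> ball (c P) r0" by (simp add: dist_norm algebra_simps)
      then show "y \<in> (\<lambda>y. y + x) ` interior (fst P)" using s by (intro image_eqI[of _ _ "y - x"]) auto
    qed
    moreover have "dist (c P + x) u \<le> M0" if "u \<in> fst T" for u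
      using that M[OF P(1)] M0[OF P(1)] unfolding P(2) by fastforce
    ultimately show "\<exists>e. ball e r0 \<subseteq> interior (fst T) \<and> (\<forall>u\<in>fst T. dist e u \<le> M0)" by blast
  qed
  then obtain e where e: "\<And>T. T \<in> \<T> \<Longrightarrow> ball (e T) r0 \<subseteq> interior (fst T)"
    "\<And>T u. T \<in> \<T> \<Longrightarrow> u \<in> fst T \<Longrightarrow> dist (e T) u \<le> M0" by metis
  let ?S = "\<T> \<sqinter>\<^sub>p cball z \<rho>"
  have S: "T \<in> \<T>" "\<exists>u\<in>fst T. dist z u \<le> \<rho>" if "T \<in> ?S" for T
    using that unfolding patch_meet_def by auto
  have sep: "r0 \<le> dist (e T) (e T')" if "T \<in> ?S" "T' \<in> ?S" "T \<noteq> T'" for T T'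
  proof (rule ccontr)
    assume "\<not> r0 \<le> dist (e T) (e T')"
    then have "e T' \<in> ball (e T) r0" by simp
    then have "e T' \<in> interior (fst T)" using e(1) S(1) that(1) by blast
    moreover have "e T' \<in> fst T'" using e(1)[OF S(1)[OF that(2)]] r0(1) interior_subset by fastforce
    ultimately have "T = T'" using tile_eqI S(1) that by blast
    then show False using that(3) by blast
  qed
  have inj: "inj_on e ?S" using sep r0(1) unfolding inj_on_def by (metis dist_self not_le)
  have "bounded (e ` ?S)"
    unfolding bounded_def
  proof (intro exI ballI)
    fix y assume "y \<in> e ` ?S"
    then obtain T where T: "T \<in> ?S" "y = e T" by blast
    obtain u where "u \<in> fst T" "dist z u \<le> \<rho>" using S(2)[OF T(1)] by blast
    then show "dist z y \<le> \<rho> + M0"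
      using e(2)[OF S(1)[OF T(1)]] T(2) dist_triangle2[of z y u] by force
  qed
  then have "finite (e ` ?S)" using sep by (intro separated_bounded_finite[OF _ r0(1)]) auto
  then show ?thesis using finite_imageD inj by blast
qed

text \<open>Walk along the segment from a point of \<open>T\<close> to its translate by
  \<open>x\<close> in steps of length at most \<open>1\<close>. Consecutive tiles met on the way lie
  in a common patch of radius \<open>2\<close>, and finite local complexity leaves finitely many
  relative positions within such patches. The vector \<open>x\<close> is a sum of these.\<close>

lemma return_vectors_finitely_generated:
  obtains D where "finite D" "return_vectors \<T> \<subseteq> int_span D"
proof -
  have FLC: "\<exists>F. finite F \<and> (\<forall>x. \<exists>P\<in>F. \<exists>y. \<T> \<sqinter>\<^sub>p set_translate (cball 0 2) x = P +\<^sub>p y)"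
    using saf unfolding self_affine_tiling_def tiling_FLC_def by (metis compact_cball)
  have st: "set_translate (cball 0 2) x = cball x 2" for x :: "real^'n"
    unfolding set_translate_def using cball_translation[of x 0 2] by (simp add: add.commute)
  obtain F where F: "finite F" "\<And>x. \<exists>P\<in>F. \<exists>y. \<T> \<sqinter>\<^sub>p cball x 2 = P +\<^sub>p y"
    using FLC unfolding st by blast
  \<comment> \<open>A tile can be a translate of several prototiles, so its position is not unique;
    all representations are recorded.\<close>
  define pos where "pos G = {(P, x). P \<in> A \<and> P +\<^sub>t x \<in> G}" for G :: "('n, 'l) tile set"
  \<comment> \<open>\<open>F\<close> may also contain infinite sets, but every patch that actually
    occurs is finite.\<close>
  define D where "D = (\<Union>G\<in>{G\<in>F. finite G}. (\<lambda>(u, v). snd v - snd u) ` (pos G \<times> pos G))"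
  have fin_pos: "finite (pos G)" if "finite G" for G
  proof (rule finite_imageD)
    let ?h = "\<lambda>(P, x). (P, P +\<^sub>t x)"
    have "?h ` pos G \<subseteq> A \<times> G" unfolding pos_def by auto
    then show "finite (?h ` pos G)" using finite_prototiles that finite_subset by blast
    show "inj_on ?h (pos G)"
    proof (rule inj_onI)
      fix a b assume "a \<in> pos G" and hab: "?h a = ?h b"
      obtain P x P' y where ab: "a = (P, x)" "b = (P', y)" by fastforce
      have "(P, x) \<in> pos G" and eq: "(P, P +\<^sub>t x) = (P', P' +\<^sub>t y)"
        using \<open>a \<in> pos G\<close> hab unfolding ab by auto
      then have "P \<in> A" unfolding pos_def by simp
      then have "x = y"
        using tile_translate_inj[of P x y] eq prototile[of P] prototile_nonempty[of P] unfolding is_tile_def by auto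
      then show "a = b" using eq unfolding ab by simp
    qed
  qed
  have "finite D" unfolding D_def using F(1) fin_pos by auto
  have D: "y - x \<in> D" if P: "P \<in> A" "P' \<in> A" and T: "P +\<^sub>t x \<in> \<T> \<sqinter>\<^sub>p cball z 2" "P' +\<^sub>t y \<in> \<T> \<sqinter>\<^sub>p cball z 2"
    for P P' x y z
  proof -
    obtain G w where G: "G \<in> F" "\<T> \<sqinter>\<^sub>p cball z 2 = G +\<^sub>p w" using F(2) by blast
    have G': "G = (\<T> \<sqinter>\<^sub>p cball z 2) +\<^sub>p (- w)" unfolding G(2) patch_translate_def by (simp add: image_image)
    have "finite G" unfolding G' patch_translate_def using finite_patch_meet by simp
    moreover have "(P, x - w) \<in> pos G" "(P', y - w) \<in> pos G"
    proof -
      have "P +\<^sub>t x +\<^sub>t (- w) \<in> G" "P' +\<^sub>t y +\<^sub>t (- w) \<in> G"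
        unfolding G' patch_translate_def using T by (blast intro: imageI)+
      then show "(P, x - w) \<in> pos G" "(P', y - w) \<in> pos G" unfolding pos_def using P by simp_all
    qed
    ultimately have "(\<lambda>(u, v). snd v - snd u) ((P, x - w), (P', y - w)) \<in> D"
      unfolding D_def using G(1) by blast
    then show ?thesis by simp
  qed
  have "return_vectors \<T> \<subseteq> int_span D"
  proof
    fix x assume "x \<in> return_vectors \<T>"
    then obtain T where T: "T \<in> \<T>" "T +\<^sub>t x \<in> \<T>" unfolding return_vectors_def by blast
    obtain P u where P: "P \<in> A" "T = P +\<^sub>t u" using T(1) tile_of_prototile by blast
    obtain c where c: "c \<in> fst T" using tile(3)[OF T(1)] by blast
    obtain N where N: "N > 0" "norm x < real N" using reals_Archimedean2[of "norm x"]
      by (metis norm_ge_zero of_nat_0_less_iff order_le_less_trans)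
    define b where "b i = c + (real i / real N) *\<^sub>R x" for i
    \<comment> \<open>The union of the tiles is only known to be dense, so tiles near
      \<open>b i\<close> are considered instead of a tile containing it. Radius \<open>1\<close>
      plus a step of length at most \<open>1\<close> explains the patch radius
      \<open>2\<close>.\<close>
    have near: "\<forall>P'\<in>A. \<forall>v. P' +\<^sub>t v \<in> \<T> \<and> fst (P' +\<^sub>t v) \<inter> ball (b i) 1 \<noteq> {} \<longrightarrow> v - u \<in> int_span D" for i
    proof (induction i)
      case 0
      have "v - u \<in> D" if "P' \<in> A" "P' +\<^sub>t v \<in> \<T>" "fst (P' +\<^sub>t v) \<inter> ball (b 0) 1 \<noteq> {}" for P' v
      proof (rule D[OF P(1) that(1)])
        show "P +\<^sub>t u \<in> \<T> \<sqinter>\<^sub>p cball (b 0) 2"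
          using T(1) c unfolding P(2)[symmetric] patch_meet_def b_def by auto
        show "P' +\<^sub>t v \<in> \<T> \<sqinter>\<^sub>p cball (b 0) 2"
          using that(2,3) unfolding patch_meet_def by fastforce
      qed
      then show ?case using zmod.span_base by blast
    next
      case (Suc i)
      obtain T' where T': "T' \<in> \<T>" "fst T' \<inter> ball (b i) 1 \<noteq> {}"
        using tiling_dense[of "ball (b i) 1"] by auto
      obtain P'' w where P'': "P'' \<in> A" "T' = P'' +\<^sub>t w" using T'(1) tile_of_prototile by blast
      have w: "w - u \<in> int_span D" using Suc P'' T' by blast
      have "b (Suc i) - b i = (1 / real N) *\<^sub>R x" unfolding b_def by (simp add: add_divide_distrib scaleR_left_distrib)
      then have step: "dist (b (Suc i)) (b i) \<le> 1" using N by (simp add: dist_norm)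
      have "v - u \<in> int_span D"
        if "P' \<in> A" "P' +\<^sub>t v \<in> \<T>" and meets: "fst (P' +\<^sub>t v) \<inter> ball (b (Suc i)) 1 \<noteq> {}" for P' v
      proof -
        have "v - w \<in> D"
        proof (rule D[OF P''(1) that(1)])
          show "P'' +\<^sub>t w \<in> \<T> \<sqinter>\<^sub>p cball (b i) 2"
            using T' unfolding P''(2)[symmetric] patch_meet_def by fastforce
          obtain y where y: "y \<in> fst (P' +\<^sub>t v)" "dist (b (Suc i)) y < 1"
            using meets unfolding disjoint_iff mem_ball by blast
          have "dist (b i) y \<le> 2" using dist_triangle[of "b i" y "b (Suc i)"] step y(2) by (simp add: dist_commute)
          then show "P' +\<^sub>t v \<in> \<T> \<sqinter>\<^sub>p cball (b i) 2"
            using that(2) y(1) unfolding patch_meet_def by auto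
        qed
        then have "(v - w) + (w - u) \<in> int_span D" using zmod.span_add[OF zmod.span_base w] by blast
        then show ?thesis by simp
      qed
      then show ?case by blast
    qed
    have "P +\<^sub>t (u + x) \<in> \<T>" using T(2) unfolding P(2) by simp
    moreover have "c + x \<in> fst (P +\<^sub>t (u + x))" using c unfolding P(2) by (auto simp: add.assoc)
    moreover have "c + x \<in> ball (b N) 1" unfolding b_def using N by simp
    ultimately have "(u + x) - u \<in> int_span D" using near[of N] P(1) by blast
    then show "x \<in> int_span D" by simp
  qed
  then show ?thesis using that \<open>finite D\<close> by blast
qed

text \<open>Let \<open>H\<close> be the group generated by all images of \<open>\<Lambda>\<close>
  under powers of \<open>R\<close>; it is invariant under \<open>R\<close> by construction. Each
  element of \<open>H\<close> has its own denominator relative to \<open>\<Lambda>\<close>, and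
  finite generation yields a common one, \<open>N\<close>. The lattice wanted is \<open>N\<close>
  times \<open>H\<close>: it lies in \<open>\<Lambda>\<close>, spans because it contains
  \<open>N\<close> times \<open>\<Lambda>\<close>, and inherits the invariance of
  \<open>H\<close>.\<close>

lemma invariant_sublattice:
  assumes L: "is_lattice \<Lambda>" and T: "periodic_under \<Lambda> T"
  obtains p \<Lambda>' where "p > 0" "is_lattice \<Lambda>'" "\<Lambda>' \<subseteq> \<Lambda>" "(q ^^ p) ` \<Lambda>' \<subseteq> \<Lambda>'"
proof -
  note sL = is_lattice_submodule[OF L]
  obtain p where p: "p > 0" "\<And>x. x \<in> \<Lambda> \<Longrightarrow> \<exists>N::nat. N > 0 \<and> real N *\<^sub>R (q ^^ p) x \<in> \<Lambda>"
    using commensurable_power[OF L T] by blast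
  obtain D where D: "finite D" "return_vectors \<T> \<subseteq> int_span D"
    using return_vectors_finitely_generated by blast
  define R where "R = q ^^ p"
  have Rl: "linear R" unfolding R_def by (rule qn_linear)
  define S where "S = (\<Union>j. (R ^^ j) ` \<Lambda>)"
  define H where "H = int_span S"
  have RS: "R ` S \<subseteq> S"
  proof
    fix y assume "y \<in> R ` S"
    then obtain j x where "x \<in> \<Lambda>" "y = R ((R ^^ j) x)" unfolding S_def by blast
    then have "y \<in> (R ^^ Suc j) ` \<Lambda>" by simp
    then show "y \<in> S" unfolding S_def by blast
  qed
  have RH: "R ` H \<subseteq> H" unfolding H_def linear_image_int_span[OF Rl] using RS by (rule zmod.span_mono)
  have "S \<subseteq> return_vectors \<T>"
  proof
    fix y assume "y \<in> S"
    then obtain j x where y: "x \<in> \<Lambda>" "y = (R ^^ j) x" unfolding S_def by blast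
    have "T \<in> \<T>" using T unfolding periodic_under_def by blast
    then obtain z where "z \<in> fst T" using tile(3) by blast
    then obtain T' where T': "periodic_under ((q ^^ (p * j)) ` \<Lambda>) T'" using periodic_under_steps[OF T] by blast
    have "y \<in> (q ^^ (p * j)) ` \<Lambda>" using y unfolding R_def funpow_mult by (simp add: mult.commute)
    then show "y \<in> return_vectors \<T>" using T' unfolding periodic_under_def return_vectors_def by blast
  qed
  then have "H \<subseteq> int_span D" unfolding H_def using D(2) zmod.subspace_span by (intro zmod.span_minimal) auto
  moreover have sH: "int_submodule H" unfolding H_def by (rule zmod.subspace_span)
  ultimately obtain D' where D': "finite D'" "H = int_span D'"
    using int_submodule_finitely_generated[OF D(1)] by blast
  have mult: "real k *\<^sub>R x \<in> \<Lambda>" if "x \<in> \<Lambda>" for k x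
    using int_submodule_closed(4)[OF sL that that, of "int k"] by simp
  have S_mult: "\<exists>N::nat. N > 0 \<and> real N *\<^sub>R (R ^^ j) x \<in> \<Lambda>" if "x \<in> \<Lambda>" for j x
  proof (induction j)
    case 0 then show ?case using that by (intro exI[of _ 1]) simp
  next
    case (Suc j)
    then obtain N where N: "N > 0" "real N *\<^sub>R (R ^^ j) x \<in> \<Lambda>" by blast
    obtain N' where N': "N' > 0" "real N' *\<^sub>R R (real N *\<^sub>R (R ^^ j) x) \<in> \<Lambda>"
      using p(2)[OF N(2)] unfolding R_def by blast
    then show ?case using N(1) by (intro exI[of _ "N' * N"]) (simp add: linear_cmul[OF Rl])
  qed
  have H_mult: "\<exists>N::nat. N > 0 \<and> real N *\<^sub>R h \<in> \<Lambda>" if "h \<in> H" for h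
    using that unfolding H_def
  proof (induction rule: zmod.span_induct_alt)
    case base then show ?case using zmod.subspace_0[OF sL] by (intro exI[of _ 1]) simp
  next
    case (step c x y)
    obtain N where N: "N > 0" "real N *\<^sub>R x \<in> \<Lambda>" using S_mult step(1) unfolding S_def by blast
    obtain N' where N': "N' > 0" "real N' *\<^sub>R y \<in> \<Lambda>" using step(2) by blast
    have "of_int c *\<^sub>R real N' *\<^sub>R real N *\<^sub>R x + real N *\<^sub>R real N' *\<^sub>R y \<in> \<Lambda>"
      using int_submodule_closed(1,4)[OF sL] mult N(2) N'(2) by blast
    then show ?case using N(1) N'(1)
      by (intro exI[of _ "N * N'"]) (simp add: scaleR_add_right mult.commute mult.left_commute)
  qed
  have "\<exists>N::nat. N > 0 \<and> (\<forall>d\<in>D'. real N *\<^sub>R d \<in> \<Lambda>)"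
  proof -
    have "\<exists>N::nat. N > 0 \<and> (\<forall>d\<in>E. real N *\<^sub>R d \<in> \<Lambda>)" if "finite E" "E \<subseteq> H" for E
      using that
    proof (induction E rule: finite_induct)
      case empty then show ?case by (intro exI[of _ 1]) simp
    next
      case (insert d E)
      obtain N where N: "N > 0" "\<And>d. d \<in> E \<Longrightarrow> real N *\<^sub>R d \<in> \<Lambda>" using insert by blast
      obtain N' where N': "N' > 0" "real N' *\<^sub>R d \<in> \<Lambda>" using H_mult insert(4) by blast
      have "real (N * N') *\<^sub>R e \<in> \<Lambda>" if "e \<in> insert d E" for e
      proof (cases "e = d")
        case True then show ?thesis using mult[OF N'(2), of N] by simp
      next
        case False
        then have "e \<in> E" using that by simp
        from mult[OF N(2)[OF this], of N'] show ?thesis by (simp add: mult.commute)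
      qed
      then show ?case using N(1) N'(1) by (intro exI[of _ "N * N'"]) simp
    qed
    then show ?thesis using D' zmod.span_superset[of D'] by blast
  qed
  then obtain N :: nat where N: "N > 0" "\<And>d. d \<in> D' \<Longrightarrow> real N *\<^sub>R d \<in> \<Lambda>" by blast
  have lin: "linear (\<lambda>x::real^'n. real N *\<^sub>R x)" by (rule linear_scale_self)
  define \<Lambda>' where "\<Lambda>' = (\<lambda>x. real N *\<^sub>R x) ` H"
  have sub: "\<Lambda>' \<subseteq> \<Lambda>"
  proof -
    have "\<Lambda>' = int_span ((\<lambda>x. real N *\<^sub>R x) ` D')" unfolding \<Lambda>'_def D'(2) linear_image_int_span[OF lin] ..
    also have "\<dots> \<subseteq> \<Lambda>" using N(2) sL by (intro zmod.span_minimal) auto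
    finally show ?thesis .
  qed
  have "span \<Lambda>' = UNIV"
  proof -
    have "\<Lambda> \<subseteq> span \<Lambda>'"
    proof
      fix x assume "x \<in> \<Lambda>"
      then have "x \<in> S" unfolding S_def by (intro UN_I[of 0]) auto
      then have "real N *\<^sub>R x \<in> \<Lambda>'" unfolding \<Lambda>'_def H_def using zmod.span_base by blast
      then have "(1 / real N) *\<^sub>R real N *\<^sub>R x \<in> span \<Lambda>'" by (intro span_scale span_base)
      then show "x \<in> span \<Lambda>'" using N(1) by simp
    qed
    then show ?thesis using span_lattice[OF L] span_mono span_span by blast
  qed
  then have "is_lattice \<Lambda>'"
    using int_submodule_linear_image[OF lin sH] sub
    by (intro is_lattice_submodule_spanning[OF L]) (simp_all add: \<Lambda>'_def)
  moreover have "R ` \<Lambda>' \<subseteq> \<Lambda>'"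
  proof -
    have "R ` \<Lambda>' = (\<lambda>x. real N *\<^sub>R x) ` R ` H"
      unfolding \<Lambda>'_def by (simp add: image_image linear_cmul[OF Rl])
    then show ?thesis unfolding \<Lambda>'_def using RH by (simp add: image_mono)
  qed
  ultimately show ?thesis using that p(1) sub unfolding R_def by blast
qed

subsection \<open>Density of the non-periodic tiles\<close>

text \<open>The interior of a nonperiodic tile misses every periodic tile. Since an open set missing
  a set also misses its closure, this passes first to the support of the periodic tiles and then
  back to the whole nonperiodic tiles, boundaries included.\<close>

lemma supp_nonperiodic_disjoint:
  assumes P: "\<P> \<subseteq> {T\<in>\<T>. \<not> periodic_under \<Lambda> T}"
  shows "supp \<P> \<inter> interior (supp {T. periodic_under \<Lambda> T}) = {}"
proof -
  let ?U = "interior (supp {T. periodic_under \<Lambda> T})"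
  have "fst S \<inter> ?U = {}" if S: "S \<in> \<P>" for S
  proof -
    have ST: "S \<in> \<T>" "\<not> periodic_under \<Lambda> S" using S P by auto
    have "interior (fst S) \<inter> fst T = {}" if "periodic_under \<Lambda> T" for T
      using tile_eqI[OF ST(1), of T] that ST(2) unfolding periodic_under_def by blast
    then have "interior (fst S) \<inter> (\<Union>T\<in>{T. periodic_under \<Lambda> T}. fst T) = {}" by blast
    then have "interior (fst S) \<inter> supp {T. periodic_under \<Lambda> T} = {}"
      unfolding supp_def by (simp add: open_Int_closure_eq_empty)
    then have "?U \<inter> interior (fst S) = {}" using interior_subset by blast
    then have "?U \<inter> closure (interior (fst S)) = {}" by (simp add: open_Int_closure_eq_empty)
    then show ?thesis using tile(2)[OF ST(1)] by auto
  qed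
  then have "?U \<inter> (\<Union>S\<in>\<P>. fst S) = {}" by blast
  then have "?U \<inter> supp \<P> = {}" unfolding supp_def by (simp add: open_Int_closure_eq_empty)
  then show ?thesis by blast
qed

lemma periodic_set_interior_supp:
  assumes L: "int_submodule \<Lambda>"
  shows "periodic_set \<Lambda> (interior (supp {T. periodic_under \<Lambda> T}))"
proof -
  let ?S = "\<Union>T\<in>{T. periodic_under \<Lambda> T}. fst T"
  have S: "(+) x ` ?S \<subseteq> ?S" if "x \<in> \<Lambda>" for x
  proof
    fix y assume "y \<in> (+) x ` ?S"
    then obtain T z where "periodic_under \<Lambda> T" "z \<in> fst T" "y = x + z" by blast
    then have "periodic_under \<Lambda> (T +\<^sub>t x)" "y \<in> fst (T +\<^sub>t x)"
      using periodic_under_translate[OF _ L that] by (auto simp: add.commute)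
    then show "y \<in> ?S" by blast
  qed
  have "(+) x ` interior (closure ?S) \<subseteq> interior (closure ?S)" if "x \<in> \<Lambda>" for x
    using interior_mono[OF closure_mono[OF S[OF that]]] by (simp only: closure_translation interior_translation)
  then have U: "y + x \<in> interior (closure ?S)" if "x \<in> \<Lambda>" "y \<in> interior (closure ?S)" for x y
    using that by (force simp: add.commute)
  show ?thesis
    unfolding periodic_set_def supp_def
  proof (intro ballI allI iffI)
    fix x y assume x: "x \<in> \<Lambda>" and y: "y + x \<in> interior (closure ?S)"
    have "y + x + (- x) \<in> interior (closure ?S)" using int_submodule_closed(3)[OF L x x] y by (rule U)
    then show "y \<in> interior (closure ?S)" by simp
  qed (rule U)
qed

text \<open>The regions \<open>U n\<close> increase, but their periods become sparser, so their
  union need not have a lattice of periods and its density need not be the limit of theirs. Pulled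
  back by \<open>R ^^ n\<close>, all of them are periodic under the single lattice
  \<open>\<Lambda>\<close>, and continuity of the measure on one fundamental domain applies.\<close>

lemma nonperiodic_tiles_zero_density:
  assumes L: "is_lattice \<Lambda>" and inv: "(q ^^ p) ` \<Lambda> \<subseteq> \<Lambda>" and p: "p > 0" and T: "periodic_under \<Lambda> T"
    and P: "\<P> = {S\<in>\<T>. \<forall>n. \<not> periodic_under ((q ^^ (p * n)) ` \<Lambda>) S}"
  shows "zero_density \<P>"
proof -
  obtain F where F: "fundamental_domain \<Lambda> F" using lattice_fundamental_domain[OF L] by blast
  note cL = is_lattice_countable[OF L] and sL = is_lattice_submodule[OF L]
  note Fm = fundamental_domain_measure[OF F cL]
  have Fb: "F \<in> sets borel" using F unfolding fundamental_domain_def by simp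
  define R where "R = q ^^ p"
  have Rl: "linear R" and Rb: "bij R" unfolding R_def by (rule qn_linear, rule qn_bij)
  have Rn: "R ^^ n = q ^^ (p * n)" for n unfolding R_def by (simp add: funpow_mult)
  have Rnl: "linear (R ^^ n)" and Rnb: "bij (R ^^ n)" for n unfolding Rn by (rule qn_linear, rule qn_bij)
  have contr: "(\<lambda>n. (inv R ^^ n) v) \<longlonglongrightarrow> 0" for v
  proof -
    have "inv R ^^ n = inv q ^^ (p * n)" for n unfolding R_def qn_inv by (simp add: funpow_mult)
    moreover have "strict_mono (\<lambda>n. p * n)" using p by (intro strict_monoI) simp
    ultimately show ?thesis using LIMSEQ_subseq_LIMSEQ[OF q_contracting[of v]] by (simp add: o_def)
  qed
  define \<Lambda>n where "\<Lambda>n n = (R ^^ n) ` \<Lambda>" for n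
  define U where "U n = interior (supp {S. periodic_under (\<Lambda>n n) S})" for n
  have \<Lambda>n_sub: "int_submodule (\<Lambda>n n)" "countable (\<Lambda>n n)" "fundamental_domain (\<Lambda>n n) ((R ^^ n) ` F)" for n
    unfolding \<Lambda>n_def using int_submodule_linear_image[OF Rnl sL] cL fundamental_domain_linear_image[OF F Rnl Rnb] by auto
  have U_open: "open (U n)" for n unfolding U_def by simp
  have U_per: "periodic_set (\<Lambda>n n) (U n)" for n unfolding U_def using \<Lambda>n_sub(1) by (rule periodic_set_interior_supp)
  have dec: "\<Lambda>n (Suc n) \<subseteq> \<Lambda>n n" for n
    using inv unfolding \<Lambda>n_def R_def[symmetric] by (auto simp: funpow_Suc_right simp del: funpow.simps)
  have U_mono: "U n \<subseteq> U (Suc n)" for n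
    unfolding U_def supp_def by (intro interior_mono closure_mono UN_mono) (auto intro: periodic_under_mono[OF _ dec])
  have RU: "R ` U n \<subseteq> U (Suc n)" for n
  proof -
    have "R ` (\<Union>S\<in>{S. periodic_under (\<Lambda>n n) S}. fst S) \<subseteq> (\<Union>S\<in>{S. periodic_under (\<Lambda>n (Suc n)) S}. fst S)"
    proof
      fix y assume "y \<in> R ` (\<Union>S\<in>{S. periodic_under (\<Lambda>n n) S}. fst S)"
      then obtain S z where "periodic_under (\<Lambda>n n) S" "z \<in> fst S" "y = R z" by blast
      then obtain S' where "periodic_under (R ` \<Lambda>n n) S'" "y \<in> fst S'"
        using periodic_under_steps[of "\<Lambda>n n" S z p] unfolding R_def by blast
      moreover have "R ` \<Lambda>n n = \<Lambda>n (Suc n)" unfolding \<Lambda>n_def by (simp add: image_comp)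
      ultimately show "y \<in> (\<Union>S\<in>{S. periodic_under (\<Lambda>n (Suc n)) S}. fst S)" by (intro UN_I[of S']) simp_all
    qed
    then have "R ` supp {S. periodic_under (\<Lambda>n n) S} \<subseteq> supp {S. periodic_under (\<Lambda>n (Suc n)) S}"
      unfolding supp_def by (meson closure_linear_image_subset Rl closure_mono order_trans)
    then have "R ` U n \<subseteq> supp {S. periodic_under (\<Lambda>n (Suc n)) S}" unfolding U_def using interior_subset by blast
    moreover have "open (R ` U n)"
      using U_open open_surjective_linear_image[OF _ Rl bij_is_surj[OF Rb]] by blast
    ultimately show ?thesis unfolding U_def by (intro interior_maximal)
  qed
  \<comment> \<open>The two growth properties have separate uses: \<open>RU\<close>, which comes
    from substitution, makes \<open>W\<close> increase, while \<open>U_mono\<close>, which comes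
    from the nested lattices, makes \<open>V\<close> invariant under \<open>inv R\<close>.\<close>
  define W where "W n = (R ^^ n) -` U n" for n
  define V where "V = (\<Union>n. W n)"
  have R_in: "R x \<in> U (Suc n)" if "x \<in> U n" for x n using RU that by blast
  have W_mono: "W n \<subseteq> W (Suc n)" for n unfolding W_def using R_in by auto
  have W_open: "open (W n)" for n
    unfolding W_def using U_open linear_bij_homeo(3)[OF Rnl Rnb] by (rule open_vimage)
  have W_image: "(R ^^ n) ` W n = U n" for n
    unfolding W_def using bij_is_surj[OF Rnb] by (rule surj_image_vimage_eq)
  have W_per: "periodic_set \<Lambda> (W n)" for n
    using U_per[of n] unfolding periodic_set_def W_def \<Lambda>n_def by (auto simp: linear_add[OF Rnl])
  have V_null: "- V \<in> null_sets lborel"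
  proof (rule expanding_ergodic[OF Rl Rb contr L])
    show "R ` \<Lambda> \<subseteq> \<Lambda>" using inv unfolding R_def .
    show "open V" unfolding V_def using W_open by blast
    have TT: "T \<in> \<T>" using T unfolding periodic_under_def by blast
    have "fst T \<subseteq> supp {S. periodic_under (\<Lambda>n 0) S}"
      unfolding supp_def \<Lambda>n_def using T closure_subset by fastforce
    then have "interior (fst T) \<subseteq> U 0" unfolding U_def by (rule interior_mono)
    then have "W 0 \<noteq> {}" unfolding W_def using tile(4)[OF TT] by auto
    then show "V \<noteq> {}" unfolding V_def by blast
    show "periodic_set \<Lambda> V" using W_per unfolding V_def periodic_set_def by blast
    show "inv R v \<in> V" if "v \<in> V" for v
    proof -
      obtain n where "(R ^^ n) v \<in> U n" using \<open>v \<in> V\<close> unfolding V_def W_def by blast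
      moreover have "(R ^^ Suc n) (inv R v) = (R ^^ n) v"
        using bij_is_surj[OF Rb] by (simp add: funpow_Suc_right surj_f_inv_f del: funpow.simps)
      ultimately have "inv R v \<in> W (Suc n)" using U_mono unfolding W_def by auto
      then show ?thesis unfolding V_def by blast
    qed
  qed
  \<comment> \<open>By linear invariance \<open>d n\<close> is also the density of the complement of
    \<open>U n\<close>.\<close>
  define d where "d n = measure lborel (- W n \<inter> F) / measure lborel F" for n
  have d_lim: "d \<longlonglongrightarrow> 0"
  proof -
    have "(\<lambda>n. measure lborel (- W n \<inter> F)) \<longlonglongrightarrow> measure lborel (\<Inter>n. - W n \<inter> F)"
    proof (rule Lim_measure_decseq)
      show "range (\<lambda>n. - W n \<inter> F) \<subseteq> sets lborel" using W_open Fb by auto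
      show "decseq (\<lambda>n. - W n \<inter> F)" using W_mono by (intro decseq_SucI) blast
      show "emeasure lborel (- W n \<inter> F) \<noteq> \<infinity>" for n
      proof -
        have "emeasure lborel (- W n \<inter> F) \<le> emeasure lborel F" using Fb by (intro emeasure_mono) auto
        then show ?thesis using Fm(1) by (auto simp: top_unique)
      qed
    qed
    moreover have "(\<Inter>n. - W n \<inter> F) = - V \<inter> F" unfolding V_def by auto
    moreover have "measure lborel (- V \<inter> F) = 0"
      by (rule measure_eq_0_null_sets[OF null_set_Int2[OF V_null]]) (simp add: Fb)
    ultimately have "(\<lambda>n. measure lborel (- W n \<inter> F) / measure lborel F) \<longlonglongrightarrow> 0 / measure lborel F"
      using Fm(2) by (intro tendsto_divide) auto
    then show ?thesis unfolding d_def by simp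
  qed
  show ?thesis
    unfolding zero_density_def
  proof (intro allI impI)
    fix B :: "nat \<Rightarrow> (real^'n) set" assume B: "van_Hove B"
    let ?r = "\<lambda>k. measure lebesgue (supp \<P> \<inter> B k) / measure lebesgue (B k)"
    have Bm: "B k \<in> lmeasurable" for k
      using B unfolding van_Hove_def by (intro fmeasurableI) (blast, metis infinity_ennreal_def)
    have cl: "closed (supp \<P>)" unfolding supp_def by simp
    \<comment> \<open>The complement of \<open>U n\<close> contains the support of
      \<open>\<P>\<close> and has density exactly \<open>d n\<close> along every van Hove sequence,
      so a single sequence \<open>d\<close> bounds all of them.\<close>
    have le: "dens B \<P> \<le> ereal (d n)" for n
    proof -
      have "- U n \<in> sets borel" using U_open[of n] by simp
      moreover have "periodic_set (\<Lambda>n n) (- U n)" using U_per[of n] unfolding periodic_set_def by simp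
      ultimately have "(\<lambda>k. measure lebesgue (- U n \<inter> B k) / measure lebesgue (B k)) \<longlonglongrightarrow>
          measure lborel (- U n \<inter> (R ^^ n) ` F) / measure lborel ((R ^^ n) ` F)"
        using \<Lambda>n_sub by (intro van_Hove_periodic_density[OF B])
      also have "- U n = (R ^^ n) ` (- W n)"
        unfolding W_image[symmetric] using bij_image_Compl_eq[OF Rnb] by simp
      also have "measure lborel ((R ^^ n) ` (- W n) \<inter> (R ^^ n) ` F) / measure lborel ((R ^^ n) ` F) = d n"
        unfolding d_def using W_open Fb by (intro measure_ratio_linear_image[OF Rnl Rnb]) auto
      finally have lim: "(\<lambda>k. measure lebesgue (- U n \<inter> B k) / measure lebesgue (B k)) \<longlonglongrightarrow> d n"
        unfolding W_image[symmetric] using bij_image_Compl_eq[OF Rnb] by simp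
      have "?r k \<le> measure lebesgue (- U n \<inter> B k) / measure lebesgue (B k)" for k
      proof (intro divide_right_mono measure_mono_fmeasurable)
        have "\<P> \<subseteq> {S\<in>\<T>. \<not> periodic_under (\<Lambda>n n) S}" unfolding P \<Lambda>n_def Rn by blast
        from supp_nonperiodic_disjoint[OF this] show "supp \<P> \<inter> B k \<subseteq> - U n \<inter> B k" unfolding U_def by blast
        have Bs: "B k \<in> sets lebesgue" using Bm by auto
        then show "supp \<P> \<inter> B k \<in> sets lebesgue" using cl by (intro sets.Int) auto
        show "- U n \<inter> B k \<in> lmeasurable"
          using Bs U_open[of n] by (intro fmeasurableI2[OF Bm]) (auto intro!: sets.Int)
      qed simp
      then have "dens B \<P> \<le> limsup (\<lambda>k. ereal (measure lebesgue (- U n \<inter> B k) / measure lebesgue (B k)))"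
        unfolding dens_def by (intro Limsup_mono) simp
      also have "\<dots> = ereal (d n)" using lim by (intro lim_imp_Limsup) auto
      finally show ?thesis .
    qed
    have "(\<lambda>n. ereal (d n)) \<longlonglongrightarrow> ereal 0" using d_lim by simp
    then have "dens B \<P> \<le> ereal 0" by (rule LIMSEQ_le_const) (use le in auto)
    moreover have "dens B \<P> \<ge> 0"
    proof -
      have "(0::ereal) = limsup (\<lambda>k. 0)" by (simp add: Limsup_const)
      also have "\<dots> \<le> dens B \<P>" unfolding dens_def by (intro Limsup_mono) simp
      finally show ?thesis .
    qed
    ultimately show "dens B \<P> = 0" by (simp add: zero_ereal_def order_antisym)
  qed
qed

end

theorem theorem4p20:
  fixes \<T> :: "('n::finite, 'l) tile set"
    and A :: "('n, 'l) tile set"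
    and Q :: "real^'n^'n"
    and \<omega> :: "('n, 'l) tile \<Rightarrow> ('n, 'l) tile set"
    and L :: "(real^'n) set"
    and K :: nat
    and T :: "('n, 'l) tile"
  assumes "subst_rule A Q \<omega>"
    and "primitive A \<omega>"
    and "subst_FLC A Q \<omega>"
    and "self_affine_tiling A Q \<omega> \<T>"
    and "pure_discrete_spectrum \<T>"
    and "is_lattice L"
    and "0 < K"
    and "T \<in> \<T>"
    and "\<forall>x\<in>Qpow Q K ` L. T +\<^sub>t x \<in> \<T>"
  shows "limit_periodic \<T> \<and>
    (\<exists>L' \<P>. is_lattice L' \<and> \<P> \<subseteq> \<T> \<and> zero_density \<P> \<and>
       (\<forall>T'\<in>\<T> - \<P>. \<exists>l::nat. \<forall>x\<in>Qpow Q l ` L'. T' +\<^sub>t x \<in> \<T>))"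
proof -
  interpret substitution_tiling A Q \<omega> \<T> using assms(1,2,4) by unfold_locales
  have L1: "is_lattice ((q ^^ K) ` L)" by (rule is_lattice_linear_image[OF assms(6) qn_linear qn_bij])
  have T1: "periodic_under ((q ^^ K) ` L) T" using assms(8,9) unfolding periodic_under_def Qpow_def by blast
  obtain p L' where p: "p > 0" "is_lattice L'" "L' \<subseteq> (q ^^ K) ` L" "(q ^^ p) ` L' \<subseteq> L'"
    using invariant_sublattice[OF L1 T1] by blast
  have T': "periodic_under L' T" using T1 p(3) by (rule periodic_under_mono)
  \<comment> \<open>One choice of \<open>L'\<close> and \<open>\<P>\<close> serves both conclusions:
    the decreasing lattices are the images of \<open>L'\<close> under \<open>q ^^ (p * n)\<close>,
    and \<open>l = p * n\<close> is the exponent in the second one.\<close>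
  define \<P> where "\<P> = {S\<in>\<T>. \<forall>n. \<not> periodic_under ((q ^^ (p * n)) ` L') S}"
  have zero: "zero_density \<P>" by (rule nonperiodic_tiles_zero_density[OF p(2,4,1) T' \<P>_def])
  have per: "\<exists>n. \<forall>x\<in>(q ^^ (p * n)) ` L'. S +\<^sub>t x \<in> \<T>" if "S \<in> \<T> - \<P>" for S
    using that unfolding \<P>_def periodic_under_def by blast
  have lat: "is_lattice ((q ^^ (p * n)) ` L')" for n
    by (rule is_lattice_linear_image[OF p(2) qn_linear qn_bij])
  have dec: "(q ^^ (p * Suc n)) ` L' \<subseteq> (q ^^ (p * n)) ` L'" for n
  proof -
    have "(q ^^ (p * Suc n)) ` L' = (q ^^ (p * n)) ` (q ^^ p) ` L'"
      by (simp add: image_comp add.commute flip: funpow_add)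
    then show ?thesis using image_mono[OF p(4)] by metis
  qed
  have "\<P> \<subseteq> \<T>" unfolding \<P>_def by blast
  moreover have "limit_periodic \<T>"
    unfolding limit_periodic_def using \<open>\<P> \<subseteq> \<T>\<close> zero lat dec per
    by (intro exI[of _ \<P>] exI[of _ "\<lambda>n. (q ^^ (p * n)) ` L'"]) simp
  moreover have "\<forall>S\<in>\<T> - \<P>. \<exists>l. \<forall>x\<in>Qpow Q l ` L'. S +\<^sub>t x \<in> \<T>"
    using per unfolding Qpow_def by blast
  ultimately show ?thesis using p(2) zero by blast
qed

end
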